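(* Fix $p\in[1,+\infty)$. Suppose that the following five conditions hold. (Regression) For a.e. $x\in\mathcal X$, $z\in\mathcal Z$ and any risk level $\alpha\in(0,1)$ there exist constants $\kappa_{p,n}(\alpha,x)>0$ and $\kappa_{p,n}(\alpha)>0$ (not depending on $z$) such that $$\mathbb P\{\|f^*(x,z)-\hat f_n(x,z)\|^p>\kappa_{p,n}^p(\alpha,x)\}\le\alpha,\qquad \mathbb P\Big\{\tfrac1n\sum_{k=1}^n\|f^*(x^k,z^k)-\hat f_n(x^k,z^k)\|^p>\kappa_{p,n}^p(\alpha)\Big\}\le\alpha.$$ (Concentration) There exist constants $c_1,c_2,c_3>0$ (depending on $\alpha$, $p$ and $d_y$) such that for all $\kappa>0$, $n\in\mathbb N$, $x\in\mathcal X$, $z\in\mathcal Z$, $$\mathbb P\{d_{W,p}(P_n^*(x,z),P_{Y|X=x,Z=z})\ge\kappa\}\le c_1\exp(-c_2n\kappa^{c_3}).$$ (Cost) The function $c(\cdot,Y(x,\cdot))$ is lower semicontinuous on $\mathcal Z$ for a.e. $x\in\mathcal X$; $c(z,Y)$ is continuous in its second argument; and there exists $C_p\ge0$ such that $|c(z,Y(x,z))|\le C_p(1+\|Y(x,z)\|^p)$ for all $x\in\mathcal X$, $z\in\mathcal Z$. (Lipschitz) Either (a) for each $z\in\mathcal Z$, $c(z,\cdot)$ is Lipschitz continuous with constant $L_1(z)$; or (b) $p\in[2,\infty)$ and for each $z\in\mathcal Z$ the gradient $\nabla c(z,\cdot)$ with respect to the second argument exists and is Lipschitz continuous with constant $L_2(z)$,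 with $\mathbb E[\|\nabla c(z,Y)\|^2]<+\infty$. (Risk levels) $\{\alpha_n\}\subset(0,1)$ satisfies $\sum_n\alpha_n<+\infty$ and $\lim_{n\to\infty}\xi_n(\alpha_n,x)=0$ for a.e. $x\in\mathcal X$, where $$\xi_n(\alpha,x):=\kappa_{p,n}(\tfrac{\alpha}{4},x)+\kappa_{p,n}(\tfrac{\alpha}{4})+\Big(\frac{\log(2c_1\alpha^{-1})}{c_2n}\Big)^{1/c_3}.$$ Then for a.e. $x\in\mathcal X$, the ER-D$^3$RO problem under the Wasserstein ambiguity sets $\hat{\mathcal P}_n(x,z;\xi_n(\alpha_n,x))$ satisfies $$|\hat v_n^{D^3RO}(x)-v^*(x)|=O_p(\xi_n(\alpha_n,x))\quad\text{and}\quad|g(\hat z_n^{D^3RO}(x),x)-v^*(x)|=O_p(\xi_n(\alpha_n,x)).$$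
   Context: Setting. $X,Z,Y$ are random vectors with supports $\mathcal X\subseteq\mathbb R^{d_x}$, $\mathcal Z\subseteq\mathbb R^{d_z}$, $\mathcal Y\subseteq\mathbb R^{d_y}$, with $\mathcal Y$ nonempty closed convex and $\mathcal Z$ nonempty compact. $Y=f^*(X,Z)+\epsilon$, where $\epsilon$ has zero mean and is independent of $X$ and $Z$, and $f^*(x,z)=\mathbb E[Y|X=x,Z=z]$. Write $Y(x,z):=f^*(x,z)+\epsilon$; $P_{Y|X=x,Z=z}$ is the conditional distribution of $Y$ given $X=x,Z=z$ (the law of $Y(x,z)$). $c(z,Y)$ is a real-valued cost function. In expressions such as $\mathbb E[\|\nabla c(z,Y)\|^2]$, $Y$ has law $P_{Y|X=x,Z=z}$. $\|\cdot\|$ is the $\ell_2$-norm. $O_p$ denotes boundedness in probability: $A_n=O_p(b_n)$ means $A_n/b_n$ is bounded in probability. True problem: $v^*(x):=\min_{z\in\mathcal Z}g(z,x)$, $g(z,x):=\mathbb E_\epsilon[c(z,f^*(x,z)+\epsilon)]$, assumed well-defined and finite with nonempty optimal solution set $S^*(x)\subseteq\mathcal Z$. Data: $D_n=\{(x^k,z^k,y^k)\}_{k=1}^n$ are joint observations of $(X,Z,Y)$ (not necessarily i.i.d.); $\mathbb P$ is the probability measure generating them. $\hat f_n$ is a regression estimate of $f^*$ computed from $D_n$; $\epsilon^k:=y^k-f^*(x^k,z^k)$ and $\hat\epsilon_n^k:=y^k-\hat f_n(x^k,z^k)$. With $\delta_y$ the Dirac measure at $y$ and $\mathrm{proj}_{\mathcal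 Y}$ the orthogonal projection onto $\mathcal Y$, let $$P_n^*(x,z):=\tfrac1n\sum_{k=1}^n\delta_{f^*(x,z)+\epsilon^k},\qquad \hat P_n^{ER}(x,z):=\tfrac1n\sum_{k=1}^n\delta_{\mathrm{proj}_{\mathcal Y}(\hat f_n(x,z)+\hat\epsilon_n^k)}.$$ $d_{W,p}$ is the $p$-Wasserstein distance with reference distance $\|y_1-y_2\|$. For a radius $\xi\ge0$, $\hat{\mathcal P}_n(x,z;\xi):=\{Q\in\mathcal P(\mathcal Y):d_{W,p}(Q,\hat P_n^{ER}(x,z))\le\xi\}$, where $\mathcal P(\mathcal Y)$ is the set of probability distributions on $\mathcal Y$. ER-D$^3$RO problem with radius $\xi$: $\hat v_n^{D^3RO}(x):=\min_{z\in\mathcal Z}\sup_{Q\in\hat{\mathcal P}_n(x,z;\xi)}\mathbb E_{Y\sim Q}[c(z,Y)]$; its objective is assumed real-valued and lower semicontinuous on $\mathcal Z$ for each $x$, so an optimal solution, denoted $\hat z_n^{D^3RO}(x)$, exists.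
   Formalization: The first regression bound is required for all z in Z on one event (read pointwise in z, the claim fails for an estimate with a spike at a data-dependent z), and the law of Y(x,z) is explicitly assumed to be carried by the support of Y for all x and z in their supports. *)

theory Defs
  imports "HOL-Probability.Probability"
begin

section \<open>Probabilistic notions\<close>

definition msupport :: "'a::topological_space measure \<Rightarrow> 'a set" where
  "msupport \<mu> = {x. \<forall>U. open U \<and> x \<in> U \<longrightarrow> emeasure \<mu> U > 0}"

text \<open>\<open>prob_space.indep_var\<close> forces both random variables to have values in the same type.\<close>

definition independent_rvs ::
    "'o measure \<Rightarrow> ('o \<Rightarrow> 'a::topological_space) \<Rightarrow> ('o \<Rightarrow> 'b::topological_space) \<Rightarrow> bool" where
  "independent_rvs M U V \<longleftrightarrow>
     prob_space.indep_set M
       (sets (vimage_algebra (space M) U borel)) (sets (vimage_algebra (space M) V borel))"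

text \<open>
  \<open>f\<close> is (a version of) \<open>(x, z) \<mapsto> E[Y | X = x, Z = z]\<close>. The library only has conditional
  expectations of real random variables, hence the coordinates \<open>Y \<bullet> b\<close>.
\<close>

definition regression_function ::
    "'o measure \<Rightarrow> ('o \<Rightarrow> 'x::euclidean_space) \<Rightarrow> ('o \<Rightarrow> 'z::euclidean_space) \<Rightarrow>
     ('o \<Rightarrow> 'y::euclidean_space) \<Rightarrow> ('x \<Rightarrow> 'z \<Rightarrow> 'y) \<Rightarrow> bool" where
  "regression_function M X Z Y f \<longleftrightarrow>
     (\<lambda>(x, z). f x z) \<in> borel_measurable borel \<and> integrable M Y \<and>
     (\<forall>b\<in>Basis. AE \<omega> in M.
        real_cond_exp M (vimage_algebra (space M) (\<lambda>\<omega>. (X \<omega>, Z \<omega>)) borel) (\<lambda>\<omega>. Y \<omega> \<bullet> b) \<omega>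
          = f (X \<omega>) (Z \<omega>) \<bullet> b)"

text \<open>
  \<open>A n = O\<^sub>p (b n)\<close>. The outer measure agrees with the probability on measurable events; it
  gives the statement its strongest meaning for optimal values and optimal solutions whose
  measurability in the data is not known. The ratio \<open>A n / b n\<close> is written without division, so
  that a vanishing \<open>b n\<close> does not trivialise the bound.
\<close>

definition bounded_in_prob :: "'w measure \<Rightarrow> (nat \<Rightarrow> 'w \<Rightarrow> real) \<Rightarrow> (nat \<Rightarrow> real) \<Rightarrow> bool" where
  "bounded_in_prob P A b \<longleftrightarrow>
     (\<forall>\<delta>>0. \<exists>B>0. \<forall>\<^sub>F n in sequentially.
        outer_measure_of P {\<omega> \<in> space P. \<bar>A n \<omega>\<bar> > B * \<bar>b n\<bar>} \<le> ennreal \<delta>)"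

definition lsc_on :: "'a::topological_space set \<Rightarrow> ('a \<Rightarrow> real) \<Rightarrow> bool" where
  "lsc_on S h \<longleftrightarrow> (\<forall>x\<in>S. \<forall>t < h x. \<forall>\<^sub>F x' in at x within S. t < h x')"


section \<open>Wasserstein distance and ambiguity sets\<close>

definition prob_on :: "'y::euclidean_space set \<Rightarrow> 'y measure set" where
  "prob_on S = {Q. prob_space Q \<and> sets Q = sets borel \<and> (AE y in Q. y \<in> S)}"

definition couplings ::
    "'y::euclidean_space measure \<Rightarrow> 'y measure \<Rightarrow> ('y \<times> 'y) measure set" where
  "couplings \<mu> \<nu> = {\<pi>. sets \<pi> = sets borel \<and> distr \<pi> borel fst = \<mu> \<and> distr \<pi> borel snd = \<nu>}"

definition ennreal_root :: "real \<Rightarrow> ennreal \<Rightarrow> ennreal" where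
  "ennreal_root p t = (if t = \<infinity> then \<infinity> else ennreal (enn2real t powr (1 / p)))"

text \<open>The value is \<open>\<infinity>\<close> if every coupling has infinite cost.\<close>

definition wasserstein ::
    "real \<Rightarrow> 'y::euclidean_space measure \<Rightarrow> 'y measure \<Rightarrow> ennreal" where
  "wasserstein p \<mu> \<nu> =
     ennreal_root p
       (INF \<pi>\<in>couplings \<mu> \<nu>. \<integral>\<^sup>+ (y1, y2). ennreal (norm (y1 - y2) powr p) \<partial>\<pi>)"

definition wasserstein_ball ::
    "real \<Rightarrow> 'y::euclidean_space set \<Rightarrow> 'y measure \<Rightarrow> real \<Rightarrow> 'y measure set" where
  "wasserstein_ball p S \<mu> \<xi> = {Q \<in> prob_on S. wasserstein p Q \<mu> \<le> ennreal \<xi>}"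


section \<open>Data and residual-based empirical laws\<close>

text \<open>The data set \<open>D\<^sub>n\<close>, as the list of the observations with indices \<open>1, \<dots>, n\<close>.\<close>

definition dataset :: "(nat \<Rightarrow> 'w \<Rightarrow> 'd) \<Rightarrow> nat \<Rightarrow> 'w \<Rightarrow> 'd list" where
  "dataset D n \<omega> = map (\<lambda>k. D k \<omega>) [1..<Suc n]"

definition empirical_law :: "'y::euclidean_space list \<Rightarrow> 'y measure" where
  "empirical_law ys = distr (uniform_count_measure {..<length ys}) borel (\<lambda>k. ys ! k)"

lemma emeasure_empirical_law:
  assumes "ys \<noteq> []" and "A \<in> sets borel"
  shows "emeasure (empirical_law ys) A =
           (\<Sum>y\<leftarrow>ys. emeasure (return borel y) A) / of_nat (length ys)"
proof -
  let ?I = "{..<length ys}"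
  let ?K = "{k \<in> ?I. ys ! k \<in> A}"
  have meas: "(\<lambda>k. ys ! k) \<in> measurable (uniform_count_measure ?I) borel"
    by (simp add: measurable_def sets_uniform_count_measure space_uniform_count_measure)
  have vim: "(\<lambda>k. ys ! k) -` A \<inter> space (uniform_count_measure ?I) = ?K"
    by (auto simp: space_uniform_count_measure)
  have "emeasure (empirical_law ys) A = emeasure (uniform_count_measure ?I) ?K"
    unfolding empirical_law_def emeasure_distr[OF meas assms(2)] vim ..
  also have "\<dots> = ennreal (real (card ?K) / real (card ?I))"
    by (rule emeasure_uniform_count_measure) auto
  also have "\<dots> = of_nat (card ?K) / of_nat (length ys)"
    using assms(1) by (simp add: ennreal_of_nat_eq_real_of_nat divide_ennreal)
  also have "of_nat (card ?K) = (\<Sum>k\<in>?I. indicator A (ys ! k) :: ennreal)"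
    by (simp add: indicator_def sum_of_bool_eq Int_def)
  also have "\<dots> = (\<Sum>y\<leftarrow>ys. emeasure (return borel y) A)"
    using assms(2) by (simp add: sum_list_sum_nth atLeast0LessThan)
  finally show ?thesis .
qed

text \<open>The points \<open>f(x, z) + (y\<^sup>k - f(x\<^sup>k, z\<^sup>k))\<close>, where \<open>s\<close> is the data set.\<close>

definition shifted_residuals ::
    "('x \<Rightarrow> 'z \<Rightarrow> 'y::euclidean_space) \<Rightarrow> ('x \<times> 'z \<times> 'y) list \<Rightarrow> 'x \<Rightarrow> 'z \<Rightarrow> 'y list" where
  "shifted_residuals f s x z = map (\<lambda>(xk, zk, yk). f x z + (yk - f xk zk)) s"

definition P_star ::
    "('x \<Rightarrow> 'z \<Rightarrow> 'y::euclidean_space) \<Rightarrow> ('x \<times> 'z \<times> 'y) list \<Rightarrow> 'x \<Rightarrow> 'z \<Rightarrow> 'y measure" where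
  "P_star f s x z = empirical_law (shifted_residuals f s x z)"

definition P_ER ::
    "'y::euclidean_space set \<Rightarrow> ('x \<Rightarrow> 'z \<Rightarrow> 'y) \<Rightarrow> ('x \<times> 'z \<times> 'y) list \<Rightarrow> 'x \<Rightarrow> 'z \<Rightarrow> 'y measure"
  where
  "P_ER S fh s x z = empirical_law (map (closest_point S) (shifted_residuals fh s x z))"

definition mean_regression_error ::
    "real \<Rightarrow> ('x \<Rightarrow> 'z \<Rightarrow> 'y::euclidean_space) \<Rightarrow> ('x \<Rightarrow> 'z \<Rightarrow> 'y) \<Rightarrow> ('x \<times> 'z \<times> 'y) list \<Rightarrow> real"
  where
  "mean_regression_error p f fh s =
     (1 / real (length s)) * (\<Sum>(xk, zk, yk)\<leftarrow>s. norm (f xk zk - fh xk zk) powr p)"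


section \<open>Objectives\<close>

definition cond_law ::
    "'o measure \<Rightarrow> ('x \<Rightarrow> 'z \<Rightarrow> 'y::euclidean_space) \<Rightarrow> ('o \<Rightarrow> 'y) \<Rightarrow> 'x \<Rightarrow> 'z \<Rightarrow> 'y measure" where
  "cond_law M f \<epsilon> x z = distr M borel (\<lambda>\<omega>. f x z + \<epsilon> \<omega>)"

definition dro_objective ::
    "('z \<Rightarrow> 'y::euclidean_space \<Rightarrow> real) \<Rightarrow> ('z \<Rightarrow> 'y measure set) \<Rightarrow> 'z \<Rightarrow> real" where
  "dro_objective c \<A> z = (SUP Q\<in>\<A> z. \<integral>y. c z y \<partial>Q)"

text \<open>
  The supremum defining \<open>dro_objective\<close> is taken in the conditionally complete lattice of the
  reals; this predicate expresses that it is a genuine, finite supremum of genuine expectations.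
\<close>

definition dro_objective_finite ::
    "('z \<Rightarrow> 'y::euclidean_space \<Rightarrow> real) \<Rightarrow> ('z \<Rightarrow> 'y measure set) \<Rightarrow> 'z \<Rightarrow> bool" where
  "dro_objective_finite c \<A> z \<longleftrightarrow>
     (\<forall>Q\<in>\<A> z. integrable Q (c z)) \<and> bdd_above ((\<lambda>Q. \<integral>y. c z y \<partial>Q) ` \<A> z)"

text \<open>
  The gradient is taken within \<open>S\<close>, so that the cost is only required to be differentiable
  relative to the (possibly lower-dimensional) closed convex set on which it matters.
\<close>

definition gradient_on ::
    "'y::euclidean_space set \<Rightarrow> ('y \<Rightarrow> real) \<Rightarrow> ('y \<Rightarrow> 'y) \<Rightarrow> bool" where
  "gradient_on S h G \<longleftrightarrow> (\<forall>y\<in>S. (h has_derivative (\<lambda>v. G y \<bullet> v)) (at y within S))"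

end

theory Submission
  imports Defs
begin

text \<open>
  Outside an event of outer probability at most \<open>\<alpha>\<^sub>n\<close>, the true conditional law
  lies in the ambiguity set for all decisions \<open>z\<close> simultaneously: the regression errors are
  bounded uniformly in \<open>z\<close>, and the distance between \<open>P\<^sub>n\<^sup>*(x, z)\<close> and the true law does not depend
  on \<open>z\<close>, because changing \<open>z\<close> translates both measures by the same vector. There
  \<open>v(x) \<le> g(zhat, x) \<le> vhat(x)\<close>. Conversely \<open>vhat(x)\<close> is at most the robust objective at a solution
  \<open>z\<^sub>0\<close> of the true problem. Every law in that ambiguity set is within \<open>2 \<xi>\<^sub>n\<close> of the true one, so its
  expected cost exceeds \<open>g(z\<^sub>0, x) = v(x)\<close> by at most a constant times \<open>\<xi>\<^sub>n\<close>.

  All triangle inequalities for the Wasserstein distance pass through an empirical law, so only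
  couplings with a finitely supported middle marginal have to be glued.
\<close>

section \<open>Transport plans\<close>

text \<open>This is Jensen's inequality for \<open>t powr p\<close> at the points
  \<open>A / a\<close> and \<open>B / b\<close> with weights \<open>a / (a + b)\<close> and
  \<open>b / (a + b)\<close>. Convexity is invoked only for positive \<open>A\<close> and
  \<open>B\<close>; a vanishing numerator is handled by \<open>shrink\<close>, because a factor
  \<open>r \<le> 1\<close> satisfies \<open>r powr p \<le> r\<close>.\<close>

lemma powr_mean_le:
  fixes A B a b p :: real
  assumes "1 \<le> p" "0 < a" "0 < b" "0 \<le> A" "0 \<le> B"
  shows "((A + B) / (a + b)) powr p \<le> a / (a + b) * (A / a) powr p + b / (a + b) * (B / b) powr p"
proof -
  have shrink: "(r * t) powr p \<le> r * t powr p" if "0 < r" "r \<le> 1" "0 \<le> t" for r t :: real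
  proof -
    have "r powr p \<le> r powr 1"
      using that assms(1) by (intro powr_mono') auto
    then show ?thesis
      using that by (simp add: powr_mult mult_right_mono)
  qed
  consider "A = 0" | "B = 0" | "0 < A" "0 < B" using assms by linarith
  then show ?thesis
  proof cases
    case 1
    have "(b / (a + b) * (B / b)) powr p \<le> b / (a + b) * (B / b) powr p"
      using assms by (intro shrink) auto
    then show ?thesis using 1 assms by simp
  next
    case 2
    have "(a / (a + b) * (A / a)) powr p \<le> a / (a + b) * (A / a) powr p"
      using assms by (intro shrink) auto
    then show ?thesis using 2 assms by simp
  next
    case 3
    have "(a / (a + b)) *\<^sub>R (A / a) + (b / (a + b)) *\<^sub>R (B / b) = (A + B) / (a + b)"
      using assms by (simp add: add_divide_distrib)
    moreover have "((a / (a + b)) *\<^sub>R (A / a) + (b / (a + b)) *\<^sub>R (B / b)) powr p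
        \<le> a / (a + b) * (A / a) powr p + b / (a + b) * (B / b) powr p"
      using powr_convex[OF assms(1)] 3 assms
      by (intro powr_convex[OF assms(1), unfolded convex_on_def, THEN conjunct2, rule_format])
         (auto simp: add_divide_distrib[symmetric])
    ultimately show ?thesis by simp
  qed
qed

text \<open>With the cost scaled by \<open>e\<close>, the triangle inequality follows from the convexity of
  \<open>t \<mapsto> t powr p\<close> alone, by \<open>powr_mean_le\<close> with the radii as weights.\<close>

definition transport_within ::
    "real \<Rightarrow> 'y::euclidean_space measure \<Rightarrow> 'y measure \<Rightarrow> real \<Rightarrow> bool" where
  "transport_within p \<mu> \<nu> e \<longleftrightarrow>
     (\<exists>\<pi>\<in>couplings \<mu> \<nu>. (\<integral>\<^sup>+(y1, y2). ennreal ((norm (y1 - y2) / e) powr p) \<partial>\<pi>) \<le> 1)"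

lemma couplingsD:
  assumes "\<pi> \<in> couplings \<mu> \<nu>"
  shows "sets \<pi> = sets borel" "distr \<pi> borel fst = \<mu>" "distr \<pi> borel snd = \<nu>"
    "space \<pi> = UNIV" "sets \<mu> = sets borel" "sets \<nu> = sets borel"
  using assms by (auto simp: couplings_def dest: sets_eq_imp_space_eq)

lemma measurable_coupling:
  assumes "\<pi> \<in> couplings \<mu> \<nu>"
  shows "measurable \<pi> N = measurable borel N"
  using couplingsD(1)[OF assms] by (rule measurable_cong_sets) simp

lemma borel_measurable_fst: "fst \<in> (borel :: ('a::topological_space \<times> 'b::topological_space) measure) \<rightarrow>\<^sub>M borel"
  by (intro borel_measurable_continuous_onI continuous_intros)

lemma borel_measurable_snd: "snd \<in> (borel :: ('a::topological_space \<times> 'b::topological_space) measure) \<rightarrow>\<^sub>M borel"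
  by (intro borel_measurable_continuous_onI continuous_intros)

lemma scaled_cost_measurable [measurable]:
  "(\<lambda>(y1, y2). ennreal ((norm (y1 - y2 :: 'y::euclidean_space) / e) powr p)) \<in> borel_measurable borel"
  unfolding borel_prod[symmetric] by measurable

text \<open>The infimum over couplings may not be attained. The strict inequality leaves room to
  choose an actual coupling whose cost lies below \<open>e powr p\<close>.\<close>

lemma transport_within_if_wasserstein_less:
  assumes p: "1 \<le> p" and e: "0 < e" and W: "wasserstein p \<mu> \<nu> < ennreal e"
  shows "transport_within p \<mu> \<nu> e"
proof -
  define I where "I = (INF \<pi>\<in>couplings \<mu> \<nu>. \<integral>\<^sup>+ (y1, y2). ennreal (norm (y1 - y2) powr p) \<partial>\<pi>)"
  have W: "ennreal_root p I < ennreal e" using W by (simp add: wasserstein_def I_def)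
  have "I \<noteq> \<infinity>"
    using W by (auto simp: ennreal_root_def)
  then obtain r where r: "I = ennreal r" "0 \<le> r" by (cases I) auto
  have "r powr (1 / p) < e"
    using W r e by (simp add: ennreal_root_def ennreal_less_iff)
  then have "(r powr (1 / p)) powr p < e powr p"
    using p by (intro powr_less_mono2) auto
  then have "r < e powr p" using p r by (simp add: powr_powr)
  then have "I < ennreal (e powr p)" using r by (simp add: ennreal_less_iff)
  then obtain \<pi> where \<pi>: "\<pi> \<in> couplings \<mu> \<nu>"
    and le: "(\<integral>\<^sup>+ (y1, y2). ennreal (norm (y1 - y2) powr p) \<partial>\<pi>) < ennreal (e powr p)"
    unfolding I_def INF_less_iff by auto
  have "(\<integral>\<^sup>+ (y1, y2). ennreal ((norm (y1 - y2) / e) powr p) \<partial>\<pi>)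
      = (\<integral>\<^sup>+ y. ennreal (1 / e powr p) * (case y of (y1, y2) \<Rightarrow> ennreal (norm (y1 - y2) powr p)) \<partial>\<pi>)"
    using e by (intro nn_integral_cong) (auto simp: powr_divide ennreal_mult[symmetric])
  also have "\<dots> = ennreal (1 / e powr p) * (\<integral>\<^sup>+ (y1, y2). ennreal (norm (y1 - y2) powr p) \<partial>\<pi>)"
    using scaled_cost_measurable[where e = 1 and p = p and 'y = 'a]
    by (intro nn_integral_cmult) (auto simp: measurable_coupling[OF \<pi>])
  also have "\<dots> \<le> ennreal (1 / e powr p) * ennreal (e powr p)"
    using le by (intro mult_left_mono) auto
  also have "\<dots> = 1" using e by (simp add: ennreal_mult[symmetric])
  finally show ?thesis unfolding transport_within_def using \<pi> by blast
qed

text \<open>Approaching \<open>a\<close> from above keeps the scale \<open>e\<close> positive, which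
  covers \<open>a = 0\<close> as well: at \<open>e = 0\<close> division by zero would make the
  scaled cost vanish.\<close>

lemma wasserstein_le_if_transport_within:
  assumes p: "1 \<le> p" and a: "0 \<le> a" and tr: "\<And>e. a < e \<Longrightarrow> transport_within p \<mu> \<nu> e"
  shows "wasserstein p \<mu> \<nu> \<le> ennreal a"
proof -
  define I where "I = (INF \<pi>\<in>couplings \<mu> \<nu>. \<integral>\<^sup>+ (y1, y2). ennreal (norm (y1 - y2) powr p) \<partial>\<pi>)"
  have I_le: "I \<le> ennreal (e powr p)" if less: "a < e" for e
  proof -
    have e: "0 < e" using a less by simp
    obtain \<pi> where \<pi>: "\<pi> \<in> couplings \<mu> \<nu>"
      and le: "(\<integral>\<^sup>+ (y1, y2). ennreal ((norm (y1 - y2) / e) powr p) \<partial>\<pi>) \<le> 1"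
      using tr[OF less] unfolding transport_within_def by blast
    have "I \<le> (\<integral>\<^sup>+ (y1, y2). ennreal (norm (y1 - y2) powr p) \<partial>\<pi>)"
      unfolding I_def using \<pi> by (rule INF_lower)
    also have "\<dots> = (\<integral>\<^sup>+ y. ennreal (e powr p) * (case y of (y1, y2) \<Rightarrow> ennreal ((norm (y1 - y2) / e) powr p)) \<partial>\<pi>)"
      using e by (intro nn_integral_cong) (auto simp: powr_divide ennreal_mult[symmetric])
    also have "\<dots> = ennreal (e powr p) * (\<integral>\<^sup>+ (y1, y2). ennreal ((norm (y1 - y2) / e) powr p) \<partial>\<pi>)"
      by (intro nn_integral_cmult) (auto simp: measurable_coupling[OF \<pi>])
    also have "\<dots> \<le> ennreal (e powr p) * 1"
      using le by (intro mult_left_mono) auto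
    finally show ?thesis by simp
  qed
  have "I \<noteq> \<infinity>" using I_le[of "a + 1"] by (auto simp: top_unique)
  then obtain r where r: "I = ennreal r" "0 \<le> r" by (cases I) auto
  have "r powr (1 / p) \<le> a"
  proof (rule field_le_epsilon)
    fix d :: real assume d: "0 < d"
    have "r \<le> (a + d) powr p"
      using I_le[of "a + d"] d r a by simp
    then have "r powr (1 / p) \<le> ((a + d) powr p) powr (1 / p)"
      using r p by (intro powr_mono2) auto
    then show "r powr (1 / p) \<le> a + d" using p a d by (simp add: powr_powr)
  qed
  then show ?thesis
    using r a unfolding wasserstein_def I_def[symmetric] by (simp add: ennreal_root_def ennreal_leI)
qed

lemma transport_within_sym:
  assumes "transport_within p \<mu> \<nu> e"
  shows "transport_within p \<nu> \<mu> e"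
proof -
  obtain \<pi> where \<pi>: "\<pi> \<in> couplings \<mu> \<nu>"
    and le: "(\<integral>\<^sup>+ (y1, y2). ennreal ((norm (y1 - y2) / e) powr p) \<partial>\<pi>) \<le> 1"
    using assms unfolding transport_within_def by blast
  let ?swap = "\<lambda>y :: 'a \<times> 'a. (snd y, fst y)"
  have swap: "?swap \<in> borel \<rightarrow>\<^sub>M borel" unfolding borel_prod[symmetric] by measurable
  have swap': "?swap \<in> \<pi> \<rightarrow>\<^sub>M borel"
    using swap by (simp only: measurable_coupling[OF \<pi>])
  have "distr (distr \<pi> borel ?swap) borel fst = \<nu>" "distr (distr \<pi> borel ?swap) borel snd = \<mu>"
    unfolding distr_distr[OF borel_measurable_fst swap'] distr_distr[OF borel_measurable_snd swap']
    by (simp_all add: comp_def couplingsD(2,3)[OF \<pi>])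
  then have "distr \<pi> borel ?swap \<in> couplings \<nu> \<mu>" by (simp add: couplings_def)
  moreover have "(\<integral>\<^sup>+ (y1, y2). ennreal ((norm (y1 - y2) / e) powr p) \<partial>distr \<pi> borel ?swap)
      = (\<integral>\<^sup>+ (y1, y2). ennreal ((norm (y1 - y2) / e) powr p) \<partial>\<pi>)"
    using swap by (subst nn_integral_distr) (auto simp: measurable_coupling[OF \<pi>] norm_minus_commute intro!: nn_integral_cong)
  ultimately show ?thesis unfolding transport_within_def using le by (intro bexI) simp_all
qed

text \<open>A nonexpansive map applied to both coordinates of a plan does not raise its cost. It
  serves for translations and for the projection onto a closed convex set.\<close>

lemma transport_within_distr:
  assumes p: "1 \<le> p" and e: "0 < e"
    and T: "T \<in> borel_measurable borel" and lip: "\<And>y1 y2. norm (T y1 - T y2) \<le> norm (y1 - y2)"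
    and tr: "transport_within p \<mu> \<nu> e"
  shows "transport_within p (distr \<mu> borel T) (distr \<nu> borel T) e"
proof -
  obtain \<pi> where \<pi>: "\<pi> \<in> couplings \<mu> \<nu>"
    and le: "(\<integral>\<^sup>+ (y1, y2). ennreal ((norm (y1 - y2) / e) powr p) \<partial>\<pi>) \<le> 1"
    using tr unfolding transport_within_def by blast
  let ?T = "\<lambda>y. (T (fst y), T (snd y))"
  note T [measurable]
  have mT: "?T \<in> borel \<rightarrow>\<^sub>M borel" unfolding borel_prod[symmetric] by measurable
  have m: "?T \<in> \<pi> \<rightarrow>\<^sub>M borel" "fst \<in> \<pi> \<rightarrow>\<^sub>M borel" "snd \<in> \<pi> \<rightarrow>\<^sub>M borel"
    using mT borel_measurable_fst borel_measurable_snd by (simp_all only: measurable_coupling[OF \<pi>])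
  have "distr (distr \<pi> borel ?T) borel fst = distr \<mu> borel T"
    unfolding couplingsD(2)[OF \<pi>, symmetric] distr_distr[OF borel_measurable_fst m(1)] distr_distr[OF T m(2)]
    by (simp add: comp_def)
  moreover have "distr (distr \<pi> borel ?T) borel snd = distr \<nu> borel T"
    unfolding couplingsD(3)[OF \<pi>, symmetric] distr_distr[OF borel_measurable_snd m(1)] distr_distr[OF T m(3)]
    by (simp add: comp_def)
  ultimately have "distr \<pi> borel ?T \<in> couplings (distr \<mu> borel T) (distr \<nu> borel T)"
    by (simp add: couplings_def)
  moreover have "(\<integral>\<^sup>+ (y1, y2). ennreal ((norm (y1 - y2) / e) powr p) \<partial>distr \<pi> borel ?T) \<le> 1"
  proof -
    have "(\<integral>\<^sup>+ (y1, y2). ennreal ((norm (y1 - y2) / e) powr p) \<partial>distr \<pi> borel ?T)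
        = (\<integral>\<^sup>+ y. ennreal ((norm (T (fst y) - T (snd y)) / e) powr p) \<partial>\<pi>)"
      using mT by (subst nn_integral_distr) (auto simp: measurable_coupling[OF \<pi>])
    also have "\<dots> \<le> (\<integral>\<^sup>+ (y1, y2). ennreal ((norm (y1 - y2) / e) powr p) \<partial>\<pi>)"
      using e p by (intro nn_integral_mono) (auto intro!: ennreal_leI powr_mono2 divide_right_mono lip)
    finally show ?thesis using le by simp
  qed
  ultimately show ?thesis unfolding transport_within_def by blast
qed

text \<open>The two plans are glued along \<open>\<nu>\<close>. As \<open>\<nu>\<close> is carried
  by finitely many atoms, conditioning on the middle point is division by the mass of an atom, so
  the glued measure has an explicit density with respect to the product of the plans.\<close>

lemma transport_within_trans_finite_support:
  fixes \<mu> \<nu> \<tau> :: "'y::euclidean_space measure"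
  assumes p: "1 \<le> p" and ab: "0 < a" "0 < b"
    and nu: "prob_space \<nu>" and S: "finite S" "AE y in \<nu>. y \<in> S"
    and tr1: "transport_within p \<mu> \<nu> a" and tr2: "transport_within p \<nu> \<tau> b"
  shows "transport_within p \<mu> \<tau> (a + b)"
proof -
  interpret nu: prob_space \<nu> by (rule nu)
  obtain \<pi>1 where \<pi>1: "\<pi>1 \<in> couplings \<mu> \<nu>"
    and le1: "(\<integral>\<^sup>+ (y1, y2). ennreal ((norm (y1 - y2) / a) powr p) \<partial>\<pi>1) \<le> 1"
    using tr1 unfolding transport_within_def by blast
  obtain \<pi>2 where \<pi>2: "\<pi>2 \<in> couplings \<nu> \<tau>"
    and le2: "(\<integral>\<^sup>+ (y1, y2). ennreal ((norm (y1 - y2) / b) powr p) \<partial>\<pi>2) \<le> 1"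
    using tr2 unfolding transport_within_def by blast
  note [measurable] = borel_measurable_fst borel_measurable_snd
  have sets [measurable_cong]: "sets \<pi>1 = sets borel" "sets \<pi>2 = sets borel" "sets \<nu> = sets borel"
    using couplingsD[OF \<pi>1] couplingsD[OF \<pi>2] by auto
  have fs: "fst \<in> \<pi>2 \<rightarrow>\<^sub>M borel" "snd \<in> \<pi>1 \<rightarrow>\<^sub>M borel"
    by measurable
  interpret p1: prob_space \<pi>1
    using nu fs(2) couplingsD(3)[OF \<pi>1] by (metis prob_space_distrD)
  interpret p2: prob_space \<pi>2
    using nu fs(1) couplingsD(2)[OF \<pi>2] by (metis prob_space_distrD)
  interpret pair: pair_sigma_finite \<pi>1 \<pi>2 ..

  \<comment> \<open>Null atoms are discarded because dividing by their mass would yield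
    \<open>\<infinity>\<close>.\<close>
  define S' where "S' = {s \<in> S. emeasure \<nu> {s} \<noteq> 0}"
  have "AE y in \<nu>. \<forall>s\<in>S. emeasure \<nu> {s} = 0 \<longrightarrow> y \<noteq> s"
    using S(1) sets(3) by (intro AE_finite_allI AE_impI AE_I[of _ _ "{_}"]) auto
  with S(2) have S': "AE y in \<nu>. y \<in> S'"
    by eventually_elim (auto simp: S'_def)
  have fin: "finite S'" using S(1) by (simp add: S'_def)
  then have S'_borel: "S' \<in> sets borel" by (intro borel_closed finite_imp_closed)
  \<comment> \<open>The couplings are glued along the middle coordinate: given the atom \<open>s\<close> of \<open>\<nu>\<close>,
    the outer coordinates are taken conditionally independent.\<close>
  define h :: "'y \<Rightarrow> 'y \<Rightarrow> ennreal" where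
    "h = (\<lambda>u w. \<Sum>s\<in>S'. indicator {s} u * indicator {s} w / emeasure \<nu> {s})"
  have h_meas [measurable]: "(\<lambda>x. h (U x) (W x)) \<in> borel_measurable K"
    if [measurable]: "U \<in> borel_measurable K" "W \<in> borel_measurable K" for U W and K :: "'k measure"
    unfolding h_def by measurable
  have h_sym: "h u w = h w u" for u w by (simp add: h_def mult.commute)
  have h_diag: "u = w" if "h u w \<noteq> 0" for u w
    using that by (auto simp: h_def indicator_def intro!: sum.neutral split: if_splits)
  \<comment> \<open>Integrating out one argument of \<open>h\<close> leaves 1 on \<open>S'\<close>,
    which carries \<open>\<nu>\<close>. By symmetry of \<open>h\<close> this shows that both plans
    are marginals of \<open>\<rho>\<close>.\<close>
  have h_int: "(\<integral>\<^sup>+ w. h u w \<partial>\<nu>) = indicator S' u" for u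
  proof -
    have "(\<integral>\<^sup>+ w. h u w \<partial>\<nu>)
        = (\<Sum>s\<in>S'. \<integral>\<^sup>+ w. indicator {s} u / emeasure \<nu> {s} * indicator {s} w \<partial>\<nu>)"
      unfolding h_def
      by (subst nn_integral_sum) (auto simp: ennreal_times_divide mult.commute intro!: sum.cong nn_integral_cong)
    also have "\<dots> = (\<Sum>s\<in>S'. indicator {s} u / emeasure \<nu> {s} * emeasure \<nu> {s})"
      using sets(3) by (intro sum.cong refl nn_integral_cmult_indicator) auto
    also have "\<dots> = (\<Sum>s\<in>S'. indicator {s} u)"
      by (intro sum.cong refl)
         (auto simp: S'_def nu.emeasure_eq_measure indicator_def ennreal_divide_times ennreal_1[symmetric]
            divide_ennreal ennreal_mult[symmetric] simp del: ennreal_1)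
    also have "\<dots> = indicator S' u" using fin by (simp add: indicator_def sum_of_bool_eq)
    finally show ?thesis .
  qed
  define \<rho> where "\<rho> = density (\<pi>1 \<Otimes>\<^sub>M \<pi>2) (\<lambda>x. h (snd (fst x)) (fst (snd x)))"
  \<comment> \<open>The marginals are computed as integral identities, which give the equalities of
    laws \<open>dist1\<close>, \<open>dist2\<close> and also the two cost integrals at the
    end.\<close>
  have int1: "(\<integral>\<^sup>+ x. F (fst x) \<partial>\<rho>) = (\<integral>\<^sup>+ u. F u \<partial>\<pi>1)"
    if [measurable]: "F \<in> borel_measurable borel" for F
  proof -
    have "(\<integral>\<^sup>+ x. F (fst x) \<partial>\<rho>) = (\<integral>\<^sup>+ x. h (snd (fst x)) (fst (snd x)) * F (fst x) \<partial>(\<pi>1 \<Otimes>\<^sub>M \<pi>2))"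
      unfolding \<rho>_def by (intro nn_integral_density) measurable
    also have "\<dots> = (\<integral>\<^sup>+ u. (\<integral>\<^sup>+ w. h (snd u) (fst w) * F u \<partial>\<pi>2) \<partial>\<pi>1)"
      by (subst p2.nn_integral_fst[symmetric]) auto
    also have "\<dots> = (\<integral>\<^sup>+ u. indicator S' (snd u) * F u \<partial>\<pi>1)"
    proof (intro nn_integral_cong)
      fix u :: "'y \<times> 'y"
      have "(\<integral>\<^sup>+ w. h (snd u) (fst w) \<partial>\<pi>2) = (\<integral>\<^sup>+ w. h (snd u) w \<partial>distr \<pi>2 borel fst)"
        by (subst nn_integral_distr) auto
      then show "(\<integral>\<^sup>+ w. h (snd u) (fst w) * F u \<partial>\<pi>2) = indicator S' (snd u) * F u"
        by (subst nn_integral_multc) (auto simp: couplingsD(2)[OF \<pi>2] h_int)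
    qed
    also have "\<dots> = (\<integral>\<^sup>+ u. F u \<partial>\<pi>1)"
    proof (rule nn_integral_cong_AE)
      have "AE u in \<pi>1. snd u \<in> S'"
        using S' unfolding couplingsD(3)[OF \<pi>1, symmetric]
        using S'_borel by (subst (asm) AE_distr_iff) auto
      then show "AE u in \<pi>1. indicator S' (snd u) * F u = F u" by eventually_elim auto
    qed
    finally show ?thesis .
  qed
  have int2: "(\<integral>\<^sup>+ x. F (snd x) \<partial>\<rho>) = (\<integral>\<^sup>+ w. F w \<partial>\<pi>2)"
    if [measurable]: "F \<in> borel_measurable borel" for F
  proof -
    have "(\<integral>\<^sup>+ x. F (snd x) \<partial>\<rho>) = (\<integral>\<^sup>+ x. h (snd (fst x)) (fst (snd x)) * F (snd x) \<partial>(\<pi>1 \<Otimes>\<^sub>M \<pi>2))"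
      unfolding \<rho>_def by (intro nn_integral_density) measurable
    also have "\<dots> = (\<integral>\<^sup>+ w. (\<integral>\<^sup>+ u. h (snd u) (fst w) * F w \<partial>\<pi>1) \<partial>\<pi>2)"
      by (subst pair.nn_integral_snd[symmetric]) auto
    also have "\<dots> = (\<integral>\<^sup>+ w. indicator S' (fst w) * F w \<partial>\<pi>2)"
    proof (intro nn_integral_cong)
      fix w :: "'y \<times> 'y"
      have "(\<integral>\<^sup>+ u. h (snd u) (fst w) \<partial>\<pi>1) = (\<integral>\<^sup>+ u. h (fst w) u \<partial>distr \<pi>1 borel snd)"
        by (subst nn_integral_distr) (auto simp: h_sym)
      then show "(\<integral>\<^sup>+ u. h (snd u) (fst w) * F w \<partial>\<pi>1) = indicator S' (fst w) * F w"
        by (subst nn_integral_multc) (auto simp: couplingsD(3)[OF \<pi>1] h_int)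
    qed
    also have "\<dots> = (\<integral>\<^sup>+ w. F w \<partial>\<pi>2)"
    proof (rule nn_integral_cong_AE)
      have "AE w in \<pi>2. fst w \<in> S'"
        using S' unfolding couplingsD(2)[OF \<pi>2, symmetric]
        using S'_borel by (subst (asm) AE_distr_iff) auto
      then show "AE w in \<pi>2. indicator S' (fst w) * F w = F w" by eventually_elim auto
    qed
    finally show ?thesis .
  qed
  have sets_\<rho> [measurable_cong]: "sets \<rho> = sets (borel \<Otimes>\<^sub>M borel)"
    unfolding \<rho>_def using sets by (simp cong: sets_pair_measure_cong)
  have dist1: "distr \<rho> borel fst = \<pi>1"
  proof (rule measure_eqI)
    fix E assume "E \<in> sets (distr \<rho> borel fst)"
    then have [measurable]: "E \<in> sets borel" by simp
    have "emeasure (distr \<rho> borel fst) E = (\<integral>\<^sup>+ x. indicator E (fst x) \<partial>\<rho>)"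
      by (subst nn_integral_indicator[symmetric], simp, subst nn_integral_distr) auto
    also have "\<dots> = emeasure \<pi>1 E" using sets by (subst int1) auto
    finally show "emeasure (distr \<rho> borel fst) E = emeasure \<pi>1 E" .
  qed (simp add: sets)
  have dist2: "distr \<rho> borel snd = \<pi>2"
  proof (rule measure_eqI)
    fix E assume "E \<in> sets (distr \<rho> borel snd)"
    then have [measurable]: "E \<in> sets borel" by simp
    have "emeasure (distr \<rho> borel snd) E = (\<integral>\<^sup>+ x. indicator E (snd x) \<partial>\<rho>)"
      by (subst nn_integral_indicator[symmetric], simp, subst nn_integral_distr) auto
    also have "\<dots> = emeasure \<pi>2 E" using sets by (subst int2) auto
    finally show "emeasure (distr \<rho> borel snd) E = emeasure \<pi>2 E" .
  qed (simp add: sets)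
  define \<pi> where "\<pi> = distr \<rho> borel (\<lambda>x. (fst (fst x), snd (snd x)))"
  have [measurable]: "(\<lambda>x. (fst (fst x), snd (snd x))) \<in> \<rho> \<rightarrow>\<^sub>M borel"
    unfolding borel_prod[symmetric] by measurable
  have "\<pi> \<in> couplings \<mu> \<tau>"
    unfolding couplings_def mem_Collect_eq
  proof (intro conjI)
    have "distr \<pi> borel fst = distr (distr \<rho> borel fst) borel fst"
      unfolding \<pi>_def by (subst (1 2) distr_distr) (auto simp: comp_def)
    then show "distr \<pi> borel fst = \<mu>" unfolding dist1 using couplingsD(2)[OF \<pi>1] by simp
    have "distr \<pi> borel snd = distr (distr \<rho> borel snd) borel snd"
      unfolding \<pi>_def by (subst (1 2) distr_distr) (auto simp: comp_def)
    then show "distr \<pi> borel snd = \<tau>" unfolding dist2 using couplingsD(3)[OF \<pi>2] by simp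
  qed (simp add: \<pi>_def)
  moreover have "(\<integral>\<^sup>+ (y1, y2). ennreal ((norm (y1 - y2) / (a + b)) powr p) \<partial>\<pi>) \<le> 1"
  proof -
    define C :: "real \<Rightarrow> 'y \<times> 'y \<Rightarrow> ennreal" where
      "C = (\<lambda>e (y1, y2). ennreal ((norm (y1 - y2) / e) powr p))"
    have [measurable]: "C e \<in> borel_measurable borel" for e
      unfolding C_def by (rule scaled_cost_measurable)
    \<comment> \<open>The density vanishes unless the two copies of the middle point coincide, so
      the triangle inequality through this point holds almost everywhere.\<close>
    have AE_diag: "AE x in \<rho>. snd (fst x) = fst (snd x)"
      unfolding \<rho>_def by (subst AE_density) (auto intro!: AE_I2 h_diag simp: zero_less_iff_neq_zero)
    have "(\<integral>\<^sup>+ y. C (a + b) y \<partial>\<pi>) = (\<integral>\<^sup>+ x. C (a + b) (fst (fst x), snd (snd x)) \<partial>\<rho>)"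
      unfolding \<pi>_def by (subst nn_integral_distr) auto
    \<comment> \<open>Each scaled cost has integral at most 1 and the weights sum to 1; this is how
      the radii \<open>a\<close> and \<open>b\<close> add up.\<close>
    also have "\<dots> \<le> (\<integral>\<^sup>+ x. ennreal (a / (a + b)) * C a (fst x) + ennreal (b / (a + b)) * C b (snd x) \<partial>\<rho>)"
    proof (rule nn_integral_mono_AE, use AE_diag in eventually_elim)
      case (elim x)
      obtain y1 y2 y3 where x: "x = ((y1, y2), (y2, y3))" using elim by (cases x) auto
      have "((norm (y1 - y3)) / (a + b)) powr p
          \<le> ((norm (y1 - y2) + norm (y2 - y3)) / (a + b)) powr p"
        using ab p by (intro powr_mono2 divide_right_mono) (auto intro: norm_diff_triangle_le)
      also have "\<dots> \<le> a / (a + b) * (norm (y1 - y2) / a) powr p + b / (a + b) * (norm (y2 - y3) / b) powr p"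
        using p ab by (intro powr_mean_le) auto
      finally show ?case
        using ab by (simp add: x C_def ennreal_mult[symmetric] ennreal_plus[symmetric] del: ennreal_plus)
    qed
    also have "\<dots> = ennreal (a / (a + b)) * (\<integral>\<^sup>+ u. C a u \<partial>\<pi>1) + ennreal (b / (a + b)) * (\<integral>\<^sup>+ w. C b w \<partial>\<pi>2)"
      by (subst nn_integral_add) (auto simp: nn_integral_cmult int1 int2)
    also have "\<dots> \<le> ennreal (a / (a + b)) * 1 + ennreal (b / (a + b)) * 1"
      using le1 le2 by (intro add_mono mult_left_mono) (auto simp: C_def)
    also have "\<dots> = 1"
      using ab by (simp add: ennreal_plus[symmetric] add_divide_distrib[symmetric] del: ennreal_plus)
    finally show ?thesis by (simp add: C_def)
  qed
  ultimately show ?thesis unfolding transport_within_def by blast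
qed

lemma nn_integral_uniform_count_measure:
  assumes "finite I"
  shows "(\<integral>\<^sup>+ k. F k \<partial>uniform_count_measure I) = (\<Sum>k\<in>I. F k) / of_nat (card I)"
proof -
  have "(\<integral>\<^sup>+ k. F k \<partial>uniform_count_measure I) = (\<Sum>k\<in>I. ennreal (1 / card I) * F k)"
    unfolding uniform_count_measure_def using assms by (rule nn_integral_point_measure_finite)
  also have "\<dots> = ennreal (1 / card I) * (\<Sum>k\<in>I. F k)"
    by (simp add: sum_distrib_left)
  also have "\<dots> = (\<Sum>k\<in>I. F k) / of_nat (card I)"
  proof (cases "card I = 0")
    case True
    then show ?thesis using assms by simp
  next
    case False
    then show ?thesis
      by (simp add: divide_ennreal_def ennreal_of_nat_eq_real_of_nat inverse_ennreal mult.commute inverse_eq_divide)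
  qed
  finally show ?thesis .
qed

lemma prob_space_empirical_law:
  assumes "ys \<noteq> []"
  shows "prob_space (empirical_law ys)"
  unfolding empirical_law_def using assms
  by (intro prob_space.prob_space_distr prob_space_uniform_count_measure) auto

lemma AE_empirical_law:
  "AE y in empirical_law ys. y \<in> set ys"
  unfolding empirical_law_def
  by (subst AE_distr_iff) (auto simp: space_uniform_count_measure finite_imp_closed intro!: AE_I2)

lemma distr_empirical_law:
  assumes "T \<in> borel_measurable borel"
  shows "distr (empirical_law ys) borel T = empirical_law (map T ys)"
  unfolding empirical_law_def using assms
  by (subst distr_distr) (auto intro!: distr_cong simp: space_uniform_count_measure)

text \<open>The plan pairs points with equal index; its cost is the average of the indexwise
  distances.\<close>

lemma transport_within_empirical_law:
  fixes ys zs :: "'y::euclidean_space list"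
  assumes len: "length zs = length ys" and ne: "ys \<noteq> []"
    and le: "(\<Sum>k<length ys. (norm (ys ! k - zs ! k) / e) powr p) \<le> length ys"
  shows "transport_within p (empirical_law ys) (empirical_law zs) e"
proof -
  let ?I = "{..<length ys}"
  define \<pi> where "\<pi> = distr (uniform_count_measure ?I) borel (\<lambda>k. (ys ! k, zs ! k))"
  have "\<pi> \<in> couplings (empirical_law ys) (empirical_law zs)"
    unfolding couplings_def \<pi>_def empirical_law_def using len
    by (auto simp: distr_distr comp_def borel_measurable_fst borel_measurable_snd)
  moreover have "(\<integral>\<^sup>+ (y1, y2). ennreal ((norm (y1 - y2) / e) powr p) \<partial>\<pi>) \<le> 1"
  proof -
    have "(\<integral>\<^sup>+ (y1, y2). ennreal ((norm (y1 - y2) / e) powr p) \<partial>\<pi>)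
       = (\<Sum>k\<in>?I. ennreal ((norm (ys ! k - zs ! k) / e) powr p)) / of_nat (length ys)"
      unfolding \<pi>_def by (subst nn_integral_distr) (auto simp: nn_integral_uniform_count_measure)
    also have "\<dots> = ennreal ((\<Sum>k\<in>?I. (norm (ys ! k - zs ! k) / e) powr p) / length ys)"
      using ne by (simp add: ennreal_of_nat_eq_real_of_nat divide_ennreal sum_nonneg)
    also have "\<dots> \<le> 1" using le ne by (simp add: divide_le_eq)
    finally show ?thesis .
  qed
  ultimately show ?thesis unfolding transport_within_def by blast
qed

section \<open>Supports and outer measures\<close>

text \<open>Every point outside the support has a basic open neighbourhood of measure zero, and a
  countable basis contains only countably many of these.\<close>

lemma AE_msupport:
  fixes \<mu> :: "'a::second_countable_topology measure"
  assumes "sets \<mu> = sets borel"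
  shows "AE x in \<mu>. x \<in> msupport \<mu>"
proof -
  obtain \<B> :: "'a set set" where \<B>: "countable \<B>" "topological_basis \<B>"
    using ex_countable_basis by blast
  define N where "N = (\<Union>B\<in>{B \<in> \<B>. emeasure \<mu> B = 0}. B)"
  have "N \<in> null_sets \<mu>"
    unfolding N_def
  proof (rule null_sets_UN')
    show "countable {B \<in> \<B>. emeasure \<mu> B = 0}" using \<B>(1) by simp
    show "B \<in> null_sets \<mu>" if "B \<in> {B \<in> \<B>. emeasure \<mu> B = 0}" for B
      using that topological_basis_open[OF \<B>(2)] assms by auto
  qed
  then have "AE x in \<mu>. x \<notin> N" by (rule AE_not_in)
  then show ?thesis
  proof eventually_elim
    case (elim x)
    have "emeasure \<mu> U > 0" if U: "open U" "x \<in> U" for U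
    proof -
      obtain B where B: "B \<in> \<B>" "x \<in> B" "B \<subseteq> U"
        using topological_basisE[OF \<B>(2) U] by blast
      have "emeasure \<mu> B > 0" using B elim by (auto simp: N_def zero_less_iff_neq_zero)
      also have "emeasure \<mu> B \<le> emeasure \<mu> U"
        using B U assms by (intro emeasure_mono) auto
      finally show ?thesis .
    qed
    then show ?case by (simp add: msupport_def)
  qed
qed

text \<open>Both sets are enlarged to measurable hulls of the same outer measure, where
  subadditivity is available.\<close>

lemma outer_measure_of_Un_le:
  assumes "A \<subseteq> space M" "B \<subseteq> space M"
  shows "outer_measure_of M (A \<union> B) \<le> outer_measure_of M A + outer_measure_of M B"
proof -
  obtain E F where E: "E \<in> sets M" "A \<subseteq> E" "outer_measure_of M A = emeasure M E"
    and F: "F \<in> sets M" "B \<subseteq> F" "outer_measure_of M B = emeasure M F"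
    using outer_measure_of_attain[OF assms(1)] outer_measure_of_attain[OF assms(2)] by blast
  have "outer_measure_of M (A \<union> B) \<le> outer_measure_of M (E \<union> F)"
    using E F by (intro outer_measure_of_mono) auto
  also have "\<dots> \<le> emeasure M E + emeasure M F"
    using E F by (simp add: emeasure_subadditive)
  finally show ?thesis using E F by simp
qed

text \<open>The event \<open>W > t\<close> is an increasing union of events \<open>W \<ge> s\<close>
  with \<open>s > t\<close>, and outer measure is continuous along increasing sequences of arbitrary
  sets. This allows \<open>t = 0\<close> although concentration is assumed at positive thresholds
  only.\<close>

lemma outer_measure_of_greater_le:
  fixes W :: "'w \<Rightarrow> ennreal"
  assumes t: "0 \<le> t"
    and le: "\<And>s. t < s \<Longrightarrow> outer_measure_of M {\<omega> \<in> space M. W \<omega> \<ge> ennreal s} \<le> b"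
  shows "outer_measure_of M {\<omega> \<in> space M. W \<omega> > ennreal t} \<le> b"
proof -
  let ?A = "\<lambda>n. {\<omega> \<in> space M. W \<omega> \<ge> ennreal (t + 1 / Suc n)}"
  have "incseq ?A"
    using t by (auto simp: incseq_def field_simps intro: order_trans[rotated] ennreal_leI)
  have "\<exists>n. ennreal (t + 1 / Suc n) \<le> W \<omega>" if W: "ennreal t < W \<omega>" for \<omega>
  proof (cases "W \<omega>")
    case (real w)
    then have "0 < w - t" using W t by (simp add: ennreal_less_iff)
    then obtain n where "1 / Suc n < w - t" using nat_approx_posE by blast
    then show ?thesis using real by (intro exI[of _ n]) (simp add: ennreal_leI)
  qed simp
  then have "{\<omega> \<in> space M. W \<omega> > ennreal t} \<subseteq> (\<Union>n. ?A n)" by auto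
  then have "outer_measure_of M {\<omega> \<in> space M. W \<omega> > ennreal t} \<le> outer_measure_of M (\<Union>n. ?A n)"
    by (rule outer_measure_of_mono)
  also have "\<dots> = (SUP n. outer_measure_of M (?A n))"
    using \<open>incseq ?A\<close> by (intro SUP_outer_measure_of_incseq[symmetric]) auto
  also have "\<dots> \<le> b" by (intro SUP_least le) simp
  finally show ?thesis .
qed

text \<open>The left side of the last hypothesis is the solution \<open>s\<close> of
  \<open>c1 * exp (- c2 * N * s powr c3) = a / 2\<close> when the logarithm is positive.\<close>

lemma exp_tail_le:
  fixes a c1 c2 c3 N s :: real
  assumes "0 < a" "0 < c1" "0 < c2" "0 < c3" "0 < N"
    and s: "(ln (2 * c1 / a) / (c2 * N)) powr (1 / c3) < s"
  shows "c1 * exp (- c2 * N * s powr c3) \<le> a / 2"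
proof -
  define l where "l = ln (2 * c1 / a)"
  have s0: "0 \<le> s" using s powr_ge_zero less_le_trans by (metis less_imp_le order_le_less_trans)
  have "l \<le> c2 * N * s powr c3"
  \<comment> \<open>A nonpositive base of \<open>powr\<close> occurs only in the first case, where
    the bound holds for every \<open>s \<ge> 0\<close>.\<close>
  proof (cases "l \<le> 0")
    case True
    then show ?thesis using assms s0 by (intro order_trans[OF True]) auto
  next
    case False
    then have "((l / (c2 * N)) powr (1 / c3)) powr c3 \<le> s powr c3"
      using s assms s0 unfolding l_def[symmetric] by (intro powr_mono2) auto
    then have "l / (c2 * N) \<le> s powr c3"
      using False assms by (simp add: powr_powr)
    then show ?thesis using assms by (simp add: field_simps)
  qed
  then have "c1 * exp (- c2 * N * s powr c3) \<le> c1 * exp (- l)"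
    using assms by (intro mult_left_mono) auto
  also have "\<dots> = a / 2"
    using assms by (simp add: l_def exp_minus field_simps)
  finally show ?thesis .
qed

section \<open>Cost differences along a transport plan\<close>

lemma one_plus_powr_ge:
  fixes t :: real
  assumes "0 \<le> t" "0 \<le> q" "q \<le> p"
  shows "t powr q \<le> 1 + t powr p"
proof (cases "t \<le> 1")
  case True
  then have "t powr q \<le> 1" using assms by (simp add: powr_le1)
  then show ?thesis using powr_ge_zero[of t p] by linarith
next
  case False
  then have "t powr q \<le> t powr p" using assms by (intro powr_mono) auto
  then show ?thesis by simp
qed

text \<open>Both Lipschitz conditions are brought to the form
  \<open>|c(y1) - c(y2)| \<le> e (H(y2) + K (|y1 - y2| / e)\<^sup>p)\<close>, whose integral under a transport plan
  of cost at most \<open>e\<^sup>p\<close> is of order \<open>e\<close>.\<close>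

lemma lipschitz_cost_gap:
  fixes c :: "'y::euclidean_space \<Rightarrow> real"
  assumes L: "L-lipschitz_on S c" and p: "1 \<le> p" and e: "0 < e" and y: "y1 \<in> S" "y2 \<in> S"
  shows "\<bar>c y1 - c y2\<bar> \<le> e * (L + L * (norm (y1 - y2) / e) powr p)"
proof -
  have L0: "0 \<le> L" using L by (rule lipschitz_on_nonneg)
  have "\<bar>c y1 - c y2\<bar> \<le> L * norm (y1 - y2)"
    using lipschitz_onD[OF L y] by (simp add: dist_norm)
  also have "\<dots> = e * L * (norm (y1 - y2) / e) powr 1" using e by simp
  also have "\<dots> \<le> e * L * (1 + (norm (y1 - y2) / e) powr p)"
    using p e L0 by (intro mult_left_mono one_plus_powr_ge) auto
  finally show ?thesis by (simp add: algebra_simps)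
qed

text \<open>By the mean value inequality on the segment, the gap is at most
  \<open>norm (G y2) * u + L * u\<^sup>2\<close>. The first term is split by Young's inequality
  after scaling by \<open>e\<close>; in the second, \<open>e \<le> 1\<close> absorbs one factor
  \<open>e\<close>. Finally \<open>2 \<le> p\<close> dominates the square by the
  \<open>p\<close>-cost. The gradient is anchored at \<open>y2\<close> because this coordinate will
  follow the true law, under which its square is integrable.\<close>

lemma gradient_cost_gap:
  fixes c :: "'y::euclidean_space \<Rightarrow> real"
  assumes S: "convex S" and G: "gradient_on S c G" and L: "L-lipschitz_on S G"
    and p: "2 \<le> p" and e: "0 < e" "e \<le> 1" and y: "y1 \<in> S" "y2 \<in> S"
  shows "\<bar>c y1 - c y2\<bar> \<le>
    e * (((norm (G y2))\<^sup>2 / 2 + 1 / 2 + L) + (1 / 2 + L) * (norm (y1 - y2) / e) powr p)"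
proof -
  define u where "u = norm (y1 - y2)"
  have L0: "0 \<le> L" using L by (rule lipschitz_on_nonneg)
  have seg: "closed_segment y2 y1 \<subseteq> S"
    using S y by (simp add: closed_segment_subset)
  have "norm (c y1 - c y2) \<le> (norm (G y2) + L * u) * norm (y1 - y2)"
  proof (rule differentiable_bound[where S = "closed_segment y2 y1" and f' = "\<lambda>y v. G y \<bullet> v"])
    fix y assume y': "y \<in> closed_segment y2 y1"
    then have "y \<in> S" using seg by auto
    then show "(c has_derivative (\<lambda>v. G y \<bullet> v)) (at y within closed_segment y2 y1)"
      using G seg unfolding gradient_on_def by (meson has_derivative_subset)
    have "norm (G y - G y2) \<le> L * norm (y - y2)"
      using lipschitz_onD[OF L \<open>y \<in> S\<close> y(2)] by (simp add: dist_norm)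
    also have "\<dots> \<le> L * u"
      using L0 segment_bound(1)[OF y'] by (intro mult_left_mono) (auto simp: u_def)
    finally have "norm (G y) \<le> norm (G y2) + L * u"
      using norm_triangle_ineq[of "G y2" "G y - G y2"] by simp
    moreover have "onorm (\<lambda>v. G y \<bullet> v) \<le> norm (G y)"
      by (rule onorm_le) (simp add: Cauchy_Schwarz_ineq2)
    ultimately show "onorm (\<lambda>v. G y \<bullet> v) \<le> norm (G y2) + L * u" by linarith
  qed auto
  then have "\<bar>c y1 - c y2\<bar> \<le> norm (G y2) * u + L * u\<^sup>2"
    by (simp add: u_def power2_eq_square algebra_simps)
  also have "norm (G y2) * u \<le> e * ((norm (G y2))\<^sup>2 / 2 + (u / e)\<^sup>2 / 2)"
  proof -
    have "0 \<le> (norm (G y2) - u / e)\<^sup>2" by simp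
    then have "norm (G y2) * (u / e) \<le> (norm (G y2))\<^sup>2 / 2 + (u / e)\<^sup>2 / 2"
      by (simp add: power2_diff)
    then have "e * (norm (G y2) * (u / e)) \<le> e * ((norm (G y2))\<^sup>2 / 2 + (u / e)\<^sup>2 / 2)"
      using e by (intro mult_left_mono) auto
    then show ?thesis using e by simp
  qed
  also have "L * u\<^sup>2 \<le> e * (L * (u / e)\<^sup>2)"
  proof -
    have "L * u\<^sup>2 = e * (e * (L * (u / e)\<^sup>2))"
      using e by (simp add: power2_eq_square)
    also have "\<dots> \<le> e * (1 * (L * (u / e)\<^sup>2))"
      using e L0 by (intro mult_left_mono mult_right_mono) auto
    finally show ?thesis by simp
  qed
  also have "e * ((norm (G y2))\<^sup>2 / 2 + (u / e)\<^sup>2 / 2) + e * (L * (u / e)\<^sup>2)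
      = e * ((norm (G y2))\<^sup>2 / 2 + (1 / 2 + L) * (u / e)\<^sup>2)"
    by (simp add: algebra_simps)
  also have "\<dots> \<le> e * ((norm (G y2))\<^sup>2 / 2 + (1 / 2 + L) * (1 + (u / e) powr p))"
  proof -
    have "0 \<le> u / e" using e by (simp add: u_def)
    then have "(u / e)\<^sup>2 \<le> 1 + (u / e) powr p"
      using one_plus_powr_ge[of "u / e" 2 p] p by (simp add: powr_numeral)
    then show ?thesis using e L0 by (intro mult_left_mono add_left_mono) auto
  qed
  finally show ?thesis by (simp add: u_def algebra_simps)
qed

text \<open>Both expectations are integrals over a single plan. Since \<open>H\<close> depends on
  the second coordinate only, its integral is taken under \<open>\<nu>\<close> and the bound is
  uniform in \<open>Q\<close>.\<close>

lemma expectation_gap_le: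
  fixes c H :: "'y::euclidean_space \<Rightarrow> real"
  assumes Q: "Q \<in> prob_on S" and nu: "\<nu> \<in> prob_on S"
    and int: "integrable Q c" "integrable \<nu> c"
    and H: "H \<in> borel_measurable borel" "\<And>y. 0 \<le> H y"
      "(\<integral>\<^sup>+ y. ennreal (H y) \<partial>\<nu>) \<le> ennreal h" "0 \<le> h" and K: "0 \<le> K" and e: "0 < e"
    and gap: "\<And>y1 y2. y1 \<in> S \<Longrightarrow> y2 \<in> S \<Longrightarrow>
        \<bar>c y1 - c y2\<bar> \<le> e * (H y2 + K * (norm (y1 - y2) / e) powr p)"
    and tr: "transport_within p Q \<nu> e"
  shows "\<bar>(\<integral>y. c y \<partial>Q) - (\<integral>y. c y \<partial>\<nu>)\<bar> \<le> e * (h + K)"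
proof -
  obtain \<pi> where \<pi>: "\<pi> \<in> couplings Q \<nu>"
    and le: "(\<integral>\<^sup>+ (y1, y2). ennreal ((norm (y1 - y2) / e) powr p) \<partial>\<pi>) \<le> 1"
    using tr unfolding transport_within_def by blast
  note marg = couplingsD(2,3)[OF \<pi>]
  have [measurable]: "fst \<in> \<pi> \<rightarrow>\<^sub>M borel" "snd \<in> \<pi> \<rightarrow>\<^sub>M borel"
    using borel_measurable_fst borel_measurable_snd by (simp_all only: measurable_coupling[OF \<pi>])
  note H(1) [measurable]
  have [measurable]: "c \<in> borel_measurable borel"
    using borel_measurable_integrable[OF int(1)] couplingsD(5)[OF \<pi>]
    by (simp cong: measurable_cong_sets)
  have C [measurable]: "(\<lambda>y. case y of (y1, y2) \<Rightarrow> ennreal ((norm (y1 - y2) / e) powr p)) \<in> borel_measurable \<pi>"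
    using scaled_cost_measurable by (simp only: measurable_coupling[OF \<pi>])
  have i1: "integrable \<pi> (\<lambda>y. c (fst y))" and i2: "integrable \<pi> (\<lambda>y. c (snd y))"
    using int unfolding marg[symmetric] by (simp_all add: integrable_distr_eq)
  have e1: "(\<integral>y. c y \<partial>Q) = (\<integral>y. c (fst y) \<partial>\<pi>)"
    unfolding marg(1)[symmetric] by (rule integral_distr) measurable
  have e2: "(\<integral>y. c y \<partial>\<nu>) = (\<integral>y. c (snd y) \<partial>\<pi>)"
    unfolding marg(2)[symmetric] by (rule integral_distr) measurable
  have s1: "AE y in \<pi>. fst y \<in> S"
    using Q unfolding marg(1)[symmetric] prob_on_def by (auto dest: AE_distrD[rotated])
  have s2: "AE y in \<pi>. snd y \<in> S"
    using nu unfolding marg(2)[symmetric] prob_on_def by (auto dest: AE_distrD[rotated])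
  have "ennreal (norm ((\<integral>y. c y \<partial>Q) - (\<integral>y. c y \<partial>\<nu>))) = ennreal (norm (\<integral>y. c (fst y) - c (snd y) \<partial>\<pi>))"
    unfolding e1 e2 using i1 i2 by simp
  also have "\<dots> \<le> (\<integral>\<^sup>+ y. ennreal (norm (c (fst y) - c (snd y))) \<partial>\<pi>)"
    using i1 i2 by (intro integral_norm_bound_ennreal) auto
  also have "\<dots> \<le> (\<integral>\<^sup>+ y. ennreal e * (ennreal (H (snd y)) + ennreal K *
      (case y of (y1, y2) \<Rightarrow> ennreal ((norm (y1 - y2) / e) powr p))) \<partial>\<pi>)"
  proof (rule nn_integral_mono_AE, use s1 s2 in eventually_elim)
    case (elim y)
    then have "norm (c (fst y) - c (snd y))
        \<le> e * (H (snd y) + K * (norm (fst y - snd y) / e) powr p)"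
      using gap by simp
    then show ?case
      using e K H(2) by (cases y) (simp add: ennreal_mult[symmetric] ennreal_plus[symmetric] ennreal_leI del: ennreal_plus)
  qed
  also have "\<dots> = ennreal e * ((\<integral>\<^sup>+ y. ennreal (H (snd y)) \<partial>\<pi>) + ennreal K *
      (\<integral>\<^sup>+ (y1, y2). ennreal ((norm (y1 - y2) / e) powr p) \<partial>\<pi>))"
    by (subst nn_integral_cmult, measurable, subst nn_integral_add, measurable, subst nn_integral_cmult, measurable)
  also have "(\<integral>\<^sup>+ y. ennreal (H (snd y)) \<partial>\<pi>) = (\<integral>\<^sup>+ y. ennreal (H y) \<partial>\<nu>)"
    unfolding marg(2)[symmetric] by (rule nn_integral_distr[symmetric]) measurable
  also have "ennreal e * (\<dots> + ennreal K * (\<integral>\<^sup>+ (y1, y2). ennreal ((norm (y1 - y2) / e) powr p) \<partial>\<pi>))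
      \<le> ennreal e * (ennreal h + ennreal K * 1)"
    using H(3) le by (intro mult_left_mono add_mono) auto
  also have "\<dots> = ennreal (e * (h + K))"
    using e K H(4) by (simp add: ennreal_mult[symmetric] ennreal_plus[symmetric] del: ennreal_plus)
  finally show ?thesis using e K H(4) by simp
qed

section \<open>The true law and the residual-based ambiguity set\<close>

text \<open>It carries a concentration event at one decision over to all others without a union
  bound, since the residuals \<open>yk - f xk zk\<close> do not involve \<open>z\<close>.\<close>

lemma wasserstein_P_star_translate:
  fixes f :: "'x \<Rightarrow> 'z \<Rightarrow> 'y::euclidean_space"
  assumes p: "1 \<le> p" and t: "0 \<le> t" and eps: "\<epsilon> \<in> borel_measurable M"
    and le: "wasserstein p (P_star f s x z) (cond_law M f \<epsilon> x z) \<le> ennreal t"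
  shows "wasserstein p (P_star f s x z') (cond_law M f \<epsilon> x z') \<le> ennreal t"
proof -
  define T where "T = (\<lambda>y :: 'y. y + (f x z' - f x z))"
  have T: "T \<in> borel_measurable borel" unfolding T_def by measurable
  note eps [measurable]
  have 1: "distr (P_star f s x z) borel T = P_star f s x z'"
    unfolding P_star_def distr_empirical_law[OF T]
    by (rule arg_cong[of _ _ empirical_law]) (simp add: shifted_residuals_def T_def split: prod.splits)
  have 2: "distr (cond_law M f \<epsilon> x z) borel T = cond_law M f \<epsilon> x z'"
    unfolding cond_law_def using T
    by (subst distr_distr) (auto simp: T_def comp_def intro!: distr_cong)
  show ?thesis
  proof (rule wasserstein_le_if_transport_within[OF p t])
    fix e assume e: "t < e"
    have "transport_within p (P_star f s x z) (cond_law M f \<epsilon> x z) e"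
      using e t p le by (intro transport_within_if_wasserstein_less) (auto simp: ennreal_less_iff elim: order.strict_trans1)
    then have "transport_within p (distr (P_star f s x z) borel T) (distr (cond_law M f \<epsilon> x z) borel T) e"
      using e t p T by (intro transport_within_distr) (auto simp: T_def)
    then show "transport_within p (P_star f s x z') (cond_law M f \<epsilon> x z') e"
      unfolding 1 2 .
  qed
qed

text \<open>The points \<open>f(x, z) + \<epsilon>\<^sup>k\<close> may lie outside \<open>S\<close>. The projection is therefore applied
  after the triangle inequality, to a coupling with the law \<open>\<nu>\<close>, which it leaves unchanged.\<close>

lemma wasserstein_P_ER_le:
  fixes f fh :: "'x \<Rightarrow> 'z \<Rightarrow> 'y::euclidean_space"
  assumes p: "1 \<le> p" and S: "closed S" "convex S" "S \<noteq> {}" and s: "s \<noteq> []"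
    and \<kappa>: "0 < \<kappa>1" "0 < \<kappa>2" and t: "0 \<le> t"
    and reg: "norm (f x z - fh x z) powr p \<le> \<kappa>1 powr p"
    and avg: "mean_regression_error p f fh s \<le> \<kappa>2 powr p"
    and nu: "\<nu> \<in> prob_on S" and W: "wasserstein p (P_star f s x z) \<nu> \<le> ennreal t"
  shows "wasserstein p \<nu> (P_ER S fh s x z) \<le> ennreal (\<kappa>1 + \<kappa>2 + t)"
proof (rule wasserstein_le_if_transport_within[OF p])
  show "0 \<le> \<kappa>1 + \<kappa>2 + t" using \<kappa> t by simp
  fix e assume e: "\<kappa>1 + \<kappa>2 + t < e"
  let ?ys = "shifted_residuals fh s x z" and ?zs = "shifted_residuals f s x z"
  have len: "length ?ys = length s" "length ?zs = length s"
    by (simp_all add: shifted_residuals_def)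
  have "transport_within p (empirical_law ?ys) (empirical_law ?zs) (\<kappa>1 + \<kappa>2)"
  proof (rule transport_within_empirical_law)
    define E where "E = (\<lambda>(xk, zk, yk :: 'y). norm (f xk zk - fh xk zk))"
    have sumE: "(\<Sum>k<length s. E (s ! k) powr p) \<le> length s * \<kappa>2 powr p"
    proof -
      have "mean_regression_error p f fh s = 1 / length s * (\<Sum>k<length s. E (s ! k) powr p)"
        unfolding mean_regression_error_def E_def
        by (simp add: sum_list_sum_nth atLeast0LessThan case_prod_unfold)
      then show ?thesis using avg s by (simp add: divide_le_eq mult.commute)
    qed
    \<comment> \<open>The two error sources are combined with the radii as weights. The error at
      \<open>(x, z)\<close> contributes at most \<open>\<kappa>1 / (\<kappa>1 + \<kappa>2)\<close>
      to each summand; the errors at the data are controlled only after summation, by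
      \<open>sumE\<close>.\<close>
    have "(\<Sum>k<length ?ys. (norm (?ys ! k - ?zs ! k) / (\<kappa>1 + \<kappa>2)) powr p)
      \<le> (\<Sum>k<length s. \<kappa>1 / (\<kappa>1 + \<kappa>2) + \<kappa>2 / (\<kappa>1 + \<kappa>2) * (E (s ! k) powr p / \<kappa>2 powr p))"
      unfolding len
    proof (rule sum_mono)
      fix k assume k: "k \<in> {..<length s}"
      obtain xk zk yk where sk: "s ! k = (xk, zk, yk)" by (cases "s ! k") auto
      have "?ys ! k - ?zs ! k = (fh x z - f x z) + (f xk zk - fh xk zk)"
        using k sk by (simp add: shifted_residuals_def)
      then have "norm (?ys ! k - ?zs ! k) \<le> norm (f x z - fh x z) + E (s ! k)"
        using norm_triangle_ineq[of "fh x z - f x z" "f xk zk - fh xk zk"] sk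
        by (simp add: E_def norm_minus_commute)
      then have "(norm (?ys ! k - ?zs ! k) / (\<kappa>1 + \<kappa>2)) powr p
          \<le> ((norm (f x z - fh x z) + E (s ! k)) / (\<kappa>1 + \<kappa>2)) powr p"
        using \<kappa> p by (intro powr_mono2 divide_right_mono) auto
      also have "\<dots> \<le> \<kappa>1 / (\<kappa>1 + \<kappa>2) * (norm (f x z - fh x z) / \<kappa>1) powr p
          + \<kappa>2 / (\<kappa>1 + \<kappa>2) * (E (s ! k) / \<kappa>2) powr p"
        using \<kappa> p by (intro powr_mean_le) (auto simp: E_def split: prod.splits)
      also have "\<dots> \<le> \<kappa>1 / (\<kappa>1 + \<kappa>2) * 1 + \<kappa>2 / (\<kappa>1 + \<kappa>2) * (E (s ! k) powr p / \<kappa>2 powr p)"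
        using \<kappa> reg by (intro add_mono mult_left_mono) (auto simp: powr_divide E_def split: prod.splits)
      finally show "(norm (?ys ! k - ?zs ! k) / (\<kappa>1 + \<kappa>2)) powr p
          \<le> \<kappa>1 / (\<kappa>1 + \<kappa>2) + \<kappa>2 / (\<kappa>1 + \<kappa>2) * (E (s ! k) powr p / \<kappa>2 powr p)" by simp
    qed
    also have "\<dots> = length s * (\<kappa>1 / (\<kappa>1 + \<kappa>2))
        + \<kappa>2 / (\<kappa>1 + \<kappa>2) * ((\<Sum>k<length s. E (s ! k) powr p) / \<kappa>2 powr p)"
      by (simp add: sum.distrib sum_distrib_left sum_divide_distrib)
    also have "\<dots> \<le> length s * (\<kappa>1 / (\<kappa>1 + \<kappa>2)) + \<kappa>2 / (\<kappa>1 + \<kappa>2) * length s"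
      using sumE \<kappa> by (intro add_left_mono mult_left_mono) (auto simp: divide_le_eq)
    also have "\<dots> = length s * ((\<kappa>1 + \<kappa>2) / (\<kappa>1 + \<kappa>2))"
      by (simp only: add_divide_distrib distrib_left mult.commute)
    also have "\<dots> = length s" using \<kappa> by simp
    finally show "(\<Sum>k<length ?ys. (norm (?ys ! k - ?zs ! k) / (\<kappa>1 + \<kappa>2)) powr p) \<le> length ?ys"
      by (simp add: len)
  qed (use s in \<open>auto simp: shifted_residuals_def\<close>)
  \<comment> \<open>The remainder of the radius \<open>e\<close> still exceeds \<open>t\<close>,
    which supplies the strict inequality needed to pick a plan.\<close>
  moreover have "transport_within p (empirical_law ?zs) \<nu> (e - \<kappa>1 - \<kappa>2)"
    using e t p \<kappa> W unfolding P_star_def[symmetric]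
    by (intro transport_within_if_wasserstein_less) (auto simp: ennreal_less_iff elim!: order.strict_trans1)
  ultimately have "transport_within p (empirical_law ?ys) \<nu> ((\<kappa>1 + \<kappa>2) + (e - \<kappa>1 - \<kappa>2))"
  proof (rule transport_within_trans_finite_support[OF p _ _ _ _ AE_empirical_law, rotated 4])
    show "prob_space (empirical_law ?zs)"
      using s by (intro prob_space_empirical_law) (simp add: shifted_residuals_def)
  qed (use \<kappa> e t in auto)
  then have tr: "transport_within p (empirical_law ?ys) \<nu> e" by simp
  have cp: "closest_point S \<in> borel_measurable borel"
    using continuous_on_closest_point[OF S(2,1,3)] by (rule borel_measurable_continuous_onI)
  have "transport_within p (distr (empirical_law ?ys) borel (closest_point S)) (distr \<nu> borel (closest_point S)) e"
    using closest_point_lipschitz[OF S(2,1,3)] p cp tr e \<kappa> t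
    by (intro transport_within_distr) (auto simp: dist_norm)
  moreover have "distr \<nu> borel (closest_point S) = \<nu>"
  proof -
    have nu': "sets \<nu> = sets borel" "AE y in \<nu>. y \<in> S" using nu by (auto simp: prob_on_def)
    have "distr \<nu> borel (closest_point S) = distr \<nu> borel (\<lambda>y. y)"
      using nu' cp by (intro distr_cong_AE) (auto elim!: eventually_mono simp: closest_point_self cong: measurable_cong_sets)
    also have "\<dots> = \<nu>" using nu' by (intro distr_id2) simp
    finally show ?thesis .
  qed
  ultimately show "transport_within p \<nu> (P_ER S fh s x z) e"
    unfolding P_ER_def distr_empirical_law[OF cp] by (simp add: transport_within_sym)
qed

theorem theorem3p10:
  fixes M :: "'o measure" and P :: "'w measure"
    and X :: "'o \<Rightarrow> 'x::euclidean_space"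
    and Z :: "'o \<Rightarrow> 'z::euclidean_space"
    and Y \<epsilon> :: "'o \<Rightarrow> 'y::euclidean_space"
    and Xs :: "'x set" and Zs :: "'z set" and Ys :: "'y set"
    and f :: "'x \<Rightarrow> 'z \<Rightarrow> 'y"
    and c :: "'z \<Rightarrow> 'y \<Rightarrow> real"
    and g :: "'z \<Rightarrow> 'x \<Rightarrow> real" and v :: "'x \<Rightarrow> real"
    and D :: "nat \<Rightarrow> 'w \<Rightarrow> 'x \<times> 'z \<times> 'y"
    and est :: "('x \<times> 'z \<times> 'y) list \<Rightarrow> 'x \<Rightarrow> 'z \<Rightarrow> 'y"
    and fhat :: "nat \<Rightarrow> 'w \<Rightarrow> 'x \<Rightarrow> 'z \<Rightarrow> 'y"
    and p :: real
    and \<kappa>x :: "nat \<Rightarrow> real \<Rightarrow> 'x \<Rightarrow> real" and \<kappa> :: "nat \<Rightarrow> real \<Rightarrow> real"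
    and c1 c2 c3 :: "real \<Rightarrow> real"
    and \<xi> :: "nat \<Rightarrow> real \<Rightarrow> 'x \<Rightarrow> real" and \<alpha> :: "nat \<Rightarrow> real"
    and \<A> :: "nat \<Rightarrow> 'w \<Rightarrow> 'x \<Rightarrow> 'z \<Rightarrow> 'y measure set"
    and vhat :: "nat \<Rightarrow> 'w \<Rightarrow> 'x \<Rightarrow> real" and zhat :: "nat \<Rightarrow> 'w \<Rightarrow> 'x \<Rightarrow> 'z"
  assumes "prob_space M" and "prob_space P"
    \<comment> \<open>population model\<close>
    and "X \<in> borel_measurable M" and "Z \<in> borel_measurable M"
    and "Y \<in> borel_measurable M" and "\<epsilon> \<in> borel_measurable M"
    and Xs: "Xs = msupport (distr M borel X)"
    and Zs: "Zs = msupport (distr M borel Z)"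
    and Ys: "Ys = msupport (distr M borel Y)"
    and "Ys \<noteq> {}" and "closed Ys" and "convex Ys"
    and "Zs \<noteq> {}" and "compact Zs"
    and model: "AE \<omega> in M. Y \<omega> = f (X \<omega>) (Z \<omega>) + \<epsilon> \<omega>"
    and "integrable M \<epsilon>" and "(\<integral>\<omega>. \<epsilon> \<omega> \<partial>M) = 0"
    and "independent_rvs M (\<lambda>\<omega>. (X \<omega>, Z \<omega>)) \<epsilon>"
    and "regression_function M X Z Y f"
    and cond_law_on_Ys: "\<And>x z. x \<in> Xs \<Longrightarrow> z \<in> Zs \<Longrightarrow> cond_law M f \<epsilon> x z \<in> prob_on Ys"
    \<comment> \<open>true problem\<close>
    and cost_borel: "\<And>z. z \<in> Zs \<Longrightarrow> c z \<in> borel_measurable borel"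
    and g_def: "g = (\<lambda>z x. \<integral>\<omega>. c z (f x z + \<epsilon> \<omega>) \<partial>M)"
    and g_finite: "\<And>x z. x \<in> Xs \<Longrightarrow> z \<in> Zs \<Longrightarrow> integrable M (\<lambda>\<omega>. c z (f x z + \<epsilon> \<omega>))"
    and v_def: "v = (\<lambda>x. INF z\<in>Zs. g z x)"
    and S_star: "\<And>x. x \<in> Xs \<Longrightarrow> \<exists>z. is_arg_min (\<lambda>z. g z x) (\<lambda>z. z \<in> Zs) z"
    \<comment> \<open>data (no joint or common law is imposed) and regression estimate\<close>
    and data_meas: "\<And>k. k \<ge> 1 \<Longrightarrow> D k \<in> borel_measurable P"
    and data_obs: "\<And>k. k \<ge> 1 \<Longrightarrow> AE \<omega> in P.
       D k \<omega> \<in> msupport (distr M borel (\<lambda>\<omega>'. (X \<omega>', Z \<omega>', Y \<omega>')))"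
    and fhat_def: "fhat = (\<lambda>n \<omega>. est (dataset D n \<omega>))"
    and p: "1 \<le> p"
    \<comment> \<open>(Regression), the constant and the exceptional event of \<open>reg_x\<close> being independent of \<open>z\<close>,
       since the bound is applied at the data-dependent decision \<open>zhat\<close>\<close>
    and reg_x: "AE x in distr M borel X. \<forall>n\<ge>1. \<forall>a\<in>{0<..<1}. \<kappa>x n a x > 0 \<and>
       outer_measure_of P {\<omega> \<in> space P. \<exists>z\<in>Zs.
         norm (f x z - fhat n \<omega> x z) powr p > \<kappa>x n a x powr p} \<le> ennreal a"
    and reg_avg: "\<forall>n\<ge>1. \<forall>a\<in>{0<..<1}. \<kappa> n a > 0 \<and>
       outer_measure_of P {\<omega> \<in> space P.
         mean_regression_error p f (fhat n \<omega>) (dataset D n \<omega>) > \<kappa> n a powr p} \<le> ennreal a"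
    \<comment> \<open>(Concentration)\<close>
    and conc: "\<forall>a\<in>{0<..<1}. c1 a > 0 \<and> c2 a > 0 \<and> c3 a > 0 \<and>
       (\<forall>t>0. \<forall>n\<ge>1. \<forall>x\<in>Xs. \<forall>z\<in>Zs.
         outer_measure_of P {\<omega> \<in> space P.
           wasserstein p (P_star f (dataset D n \<omega>) x z) (cond_law M f \<epsilon> x z) \<ge> ennreal t}
         \<le> ennreal (c1 a * exp (- c2 a * real n * t powr c3 a)))"
    \<comment> \<open>(Cost)\<close>
    and cost_lsc: "AE x in distr M borel X. AE \<omega> in M. lsc_on Zs (\<lambda>z. c z (f x z + \<epsilon> \<omega>))"
    and cost_cont: "\<forall>z\<in>Zs. continuous_on Ys (c z)"
    and cost_growth: "\<exists>C\<ge>0. \<forall>x\<in>Xs. \<forall>z\<in>Zs. AE \<omega> in M.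
       \<bar>c z (f x z + \<epsilon> \<omega>)\<bar> \<le> C * (1 + norm (f x z + \<epsilon> \<omega>) powr p)"
    \<comment> \<open>(Lipschitz)\<close>
    and lipschitz: "(\<exists>L1. \<forall>z\<in>Zs. (L1 z)-lipschitz_on Ys (c z)) \<or>
       (2 \<le> p \<and> (\<exists>L2 G. \<forall>z\<in>Zs. gradient_on Ys (c z) (G z) \<and> (L2 z)-lipschitz_on Ys (G z) \<and>
          (\<forall>x\<in>Xs. (\<integral>\<^sup>+ y. ennreal ((norm (G z y))\<^sup>2) \<partial>cond_law M f \<epsilon> x z) < \<infinity>)))"
    \<comment> \<open>(Risk levels)\<close>
    and xi_def: "\<xi> = (\<lambda>n a x. \<kappa>x n (a / 4) x + \<kappa> n (a / 4) +
       (ln (2 * c1 a / a) / (c2 a * real n)) powr (1 / c3 a))"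
    and "\<And>n. \<alpha> n \<in> {0<..<1}" and "summable \<alpha>"
    and "AE x in distr M borel X. (\<lambda>n. \<xi> n (\<alpha> n) x) \<longlonglongrightarrow> 0"
    \<comment> \<open>the robust problem with radius \<open>\<xi> n (\<alpha> n) x\<close>\<close>
    and A_def: "\<A> = (\<lambda>n \<omega> x z.
       wasserstein_ball p Ys (P_ER Ys (fhat n \<omega>) (dataset D n \<omega>) x z) (\<xi> n (\<alpha> n) x))"
    and dro_finite: "\<And>n \<omega> x z. n \<ge> 1 \<Longrightarrow> \<omega> \<in> space P \<Longrightarrow> x \<in> Xs \<Longrightarrow> z \<in> Zs \<Longrightarrow>
       dro_objective_finite c (\<A> n \<omega> x) z"
    and dro_lsc: "\<And>n \<omega> x. n \<ge> 1 \<Longrightarrow> \<omega> \<in> space P \<Longrightarrow> x \<in> Xs \<Longrightarrow>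
       lsc_on Zs (dro_objective c (\<A> n \<omega> x))"
    and vhat_def: "vhat = (\<lambda>n \<omega> x. INF z\<in>Zs. dro_objective c (\<A> n \<omega> x) z)"
    and zhat: "\<And>n \<omega> x. n \<ge> 1 \<Longrightarrow> \<omega> \<in> space P \<Longrightarrow> x \<in> Xs \<Longrightarrow>
       is_arg_min (dro_objective c (\<A> n \<omega> x)) (\<lambda>z. z \<in> Zs) (zhat n \<omega> x)"
  shows "AE x in distr M borel X.
     bounded_in_prob P (\<lambda>n \<omega>. \<bar>vhat n \<omega> x - v x\<bar>) (\<lambda>n. \<xi> n (\<alpha> n) x) \<and>
     bounded_in_prob P (\<lambda>n \<omega>. \<bar>g (zhat n \<omega> x) x - v x\<bar>) (\<lambda>n. \<xi> n (\<alpha> n) x)"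
proof -

  \<comment> \<open>Reduction to a fixed covariate in the support\<close>
  note msr = \<open>\<epsilon> \<in> borel_measurable M\<close>
  have \<alpha>: "0 < \<alpha> n" "\<alpha> n < 1" for n using \<open>\<And>n. \<alpha> n \<in> {0<..<1}\<close>[of n] by auto
  have "AE x in distr M borel X. x \<in> Xs"
    unfolding Xs by (rule AE_msupport) simp
  with reg_x \<open>AE x in distr M borel X. (\<lambda>n. \<xi> n (\<alpha> n) x) \<longlonglongrightarrow> 0\<close>
  show ?thesis
  proof eventually_elim
    case (elim x)
    note reg = elim(1) and lim = elim(2) and x = elim(3)
    define \<nu> where "\<nu> = cond_law M f \<epsilon> x"
    define r where "r = (\<lambda>n. \<xi> n (\<alpha> n) x)"
    define t where "t = (\<lambda>n. (ln (2 * c1 (\<alpha> n) / \<alpha> n) / (c2 (\<alpha> n) * real n)) powr (1 / c3 (\<alpha> n)))"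
    define \<kappa>1 where "\<kappa>1 = (\<lambda>n. \<kappa>x n (\<alpha> n / 4) x)"
    define \<kappa>2 where "\<kappa>2 = (\<lambda>n. \<kappa> n (\<alpha> n / 4))"
    define obj where "obj = (\<lambda>n \<omega>. dro_objective c (\<A> n \<omega> x))"
    have r_eq: "r n = \<kappa>1 n + \<kappa>2 n + t n" for n
      by (simp add: r_def xi_def \<kappa>1_def \<kappa>2_def t_def)
    have \<alpha>4: "\<alpha> n / 4 \<in> {0<..<1}" for n using \<alpha>[of n] by auto
    have \<kappa>pos: "0 < \<kappa>1 n" "0 < \<kappa>2 n" if n: "n \<ge> 1" for n
      using reg[rule_format, OF n \<alpha>4] reg_avg[rule_format, OF n \<alpha>4] unfolding \<kappa>1_def \<kappa>2_def
      by (simp_all only:)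
    have t0: "0 \<le> t n" for n by (simp add: t_def)
    have r0: "0 < r n" if "n \<ge> 1" for n using \<kappa>pos[OF that] t0[of n] by (simp add: r_eq)
    have eps_shift: "(\<lambda>\<omega>. f x z + \<epsilon> \<omega>) \<in> borel_measurable M" for z
      using msr by simp
    have nu: "\<nu> z \<in> prob_on Ys" if "z \<in> Zs" for z
      using cond_law_on_Ys[OF x that] by (simp add: \<nu>_def)
    have g_eq: "g z x = (\<integral>y. c z y \<partial>\<nu> z)" and int_nu: "integrable (\<nu> z) (c z)" if "z \<in> Zs" for z
      using g_finite[OF x that] cost_borel[OF that] eps_shift
      by (simp_all add: g_def \<nu>_def cond_law_def integral_distr integrable_distr_eq)
    \<comment> \<open>All constants of the final bound are taken at this one solution, so the
      Lipschitz constants may be unbounded in \<open>z\<close>.\<close>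
    obtain z0 where z0: "z0 \<in> Zs" and z0_min: "\<And>z. z \<in> Zs \<Longrightarrow> g z0 x \<le> g z x"
      using S_star[OF x] unfolding is_arg_min_linorder by blast
    have v_eq: "v x = g z0 x"
      unfolding v_def using z0 z0_min by (intro cInf_eq_minimum) auto

    \<comment> \<open>Modulus of the cost at the true solution\<close>
    obtain H :: "'y \<Rightarrow> real" and K h :: real where H: "H \<in> borel_measurable borel" "\<And>y. 0 \<le> H y"
        "(\<integral>\<^sup>+ y. ennreal (H y) \<partial>\<nu> z0) \<le> ennreal h" "0 \<le> h" and K: "0 \<le> K"
      and gap: "\<And>e y1 y2. 0 < e \<Longrightarrow> e \<le> 1 \<Longrightarrow> y1 \<in> Ys \<Longrightarrow> y2 \<in> Ys \<Longrightarrow>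
        \<bar>c z0 y1 - c z0 y2\<bar> \<le> e * (H y2 + K * (norm (y1 - y2) / e) powr p)"
    proof -
      interpret nu0: prob_space "\<nu> z0" using nu[OF z0] by (simp add: prob_on_def)
      from lipschitz show ?thesis
      proof (elim disjE exE conjE)
        fix L1 assume L1: "\<forall>z\<in>Zs. (L1 z)-lipschitz_on Ys (c z)"
        then have L: "(L1 z0)-lipschitz_on Ys (c z0)" using z0 by blast
        have L0: "0 \<le> L1 z0" using L by (rule lipschitz_on_nonneg)
        show ?thesis
          using L L0 p by (intro that[of "\<lambda>_. L1 z0" "L1 z0" "L1 z0"] lipschitz_cost_gap)
            (auto simp: nu0.emeasure_space_1)
      next
        fix L2 G
        assume p2: "2 \<le> p" and "\<forall>z\<in>Zs. gradient_on Ys (c z) (G z) \<and> (L2 z)-lipschitz_on Ys (G z) \<and>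
          (\<forall>x\<in>Xs. (\<integral>\<^sup>+ y. ennreal ((norm (G z y))\<^sup>2) \<partial>cond_law M f \<epsilon> x z) < \<infinity>)"
        then have G: "gradient_on Ys (c z0) (G z0)" and L: "(L2 z0)-lipschitz_on Ys (G z0)"
          and fin: "(\<integral>\<^sup>+ y. ennreal ((norm (G z0 y))\<^sup>2) \<partial>\<nu> z0) < \<infinity>"
          using z0 x by (auto simp: \<nu>_def)
        have L0: "0 \<le> L2 z0" using L by (rule lipschitz_on_nonneg)
        \<comment> \<open>Off \<open>Ys\<close> the map \<open>G z0\<close> is arbitrary and may
          fail to be measurable; on \<open>Ys\<close> it is continuous, being Lipschitz.\<close>
        define F where "F = (\<lambda>y. indicator Ys y * (norm (G z0 y))\<^sup>2)"
        have F: "F \<in> borel_measurable borel"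
        proof -
          have "(\<lambda>y. indicator Ys y *\<^sub>R (norm (G z0 y))\<^sup>2) \<in> borel_measurable borel"
            using lipschitz_on_continuous_on[OF L] \<open>closed Ys\<close>
            by (intro borel_measurable_continuous_on_indicator continuous_intros) auto
          then show ?thesis by (simp add: F_def)
        qed
        have "(\<integral>\<^sup>+ y. ennreal (F y) \<partial>\<nu> z0) \<le> (\<integral>\<^sup>+ y. ennreal ((norm (G z0 y))\<^sup>2) \<partial>\<nu> z0)"
          by (intro nn_integral_mono) (auto simp: F_def indicator_def)
        with fin obtain a where a: "(\<integral>\<^sup>+ y. ennreal (F y) \<partial>\<nu> z0) = ennreal a" "0 \<le> a"
          by (cases "\<integral>\<^sup>+ y. ennreal (F y) \<partial>\<nu> z0") (auto simp: top_unique)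
        have F_nu: "F \<in> borel_measurable (\<nu> z0)"
          using F by (simp add: \<nu>_def cond_law_def)
        have F0: "0 \<le> F y" for y by (simp add: F_def)
        show ?thesis
        \<comment> \<open>The witnesses for \<open>H\<close> and \<open>K\<close> are read off from
          \<open>gradient_cost_gap\<close>; \<open>h\<close> bounds the integral of
          \<open>F / 2\<close> generously by \<open>a\<close>.\<close>
        proof (rule that[of "\<lambda>y. F y / 2 + 1 / 2 + L2 z0" "a + 1 / 2 + L2 z0" "1 / 2 + L2 z0"])
          show "(\<lambda>y. F y / 2 + 1 / 2 + L2 z0) \<in> borel_measurable borel" using F by measurable
          have "(\<integral>\<^sup>+ y. ennreal (F y / 2 + 1 / 2 + L2 z0) \<partial>\<nu> z0)
              \<le> (\<integral>\<^sup>+ y. ennreal (F y) + ennreal (1 / 2 + L2 z0) \<partial>\<nu> z0)"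
            using F0 L0 by (intro nn_integral_mono)
              (simp add: ennreal_plus[symmetric] ennreal_leI del: ennreal_plus)
          also have "\<dots> = ennreal a + ennreal (1 / 2 + L2 z0)"
            using F_nu by (subst nn_integral_add) (auto simp: a nu0.emeasure_space_1)
          also have "\<dots> = ennreal (a + 1 / 2 + L2 z0)"
            using a L0 by (simp add: ennreal_plus[symmetric] add.assoc del: ennreal_plus)
          finally show "(\<integral>\<^sup>+ y. ennreal (F y / 2 + 1 / 2 + L2 z0) \<partial>\<nu> z0) \<le> ennreal (a + 1 / 2 + L2 z0)" .
          show "\<bar>c z0 y1 - c z0 y2\<bar> \<le> e * ((F y2 / 2 + 1 / 2 + L2 z0)
              + (1 / 2 + L2 z0) * (norm (y1 - y2) / e) powr p)"
            if "0 < e" "e \<le> 1" "y1 \<in> Ys" "y2 \<in> Ys" for e y1 y2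
            using gradient_cost_gap[OF \<open>convex Ys\<close> G L p2 that] that by (simp add: F_def)
        qed (use F0 L0 a in auto)
      qed
    qed

    \<comment> \<open>The factor 3 is the scale \<open>3 * r n\<close> at which plans between
      \<open>Q\<close> and the true law are found below; adding 1 keeps \<open>B\<close> positive
      when \<open>h = K = 0\<close>.\<close>
    define B where "B = 3 * (h + K) + 1"

    \<comment> \<open>Probability of the exceptional event\<close>
    define bad1 where "bad1 = (\<lambda>n. {\<omega> \<in> space P. \<exists>z\<in>Zs. norm (f x z - fhat n \<omega> x z) powr p > \<kappa>1 n powr p})"
    define bad2 where "bad2 = (\<lambda>n. {\<omega> \<in> space P.
      mean_regression_error p f (fhat n \<omega>) (dataset D n \<omega>) > \<kappa>2 n powr p})"
    \<comment> \<open>Only \<open>z0\<close> enters here; translation extends the complementary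
      bound to all decisions. In contrast, \<open>bad1\<close> must range over all \<open>z\<close>
      to cover the data-dependent \<open>zhat\<close>.\<close>
    define bad3 where "bad3 = (\<lambda>n. {\<omega> \<in> space P.
      wasserstein p (P_star f (dataset D n \<omega>) x z0) (\<nu> z0) > ennreal (t n)})"
    define bad where "bad = (\<lambda>n. bad1 n \<union> bad2 n \<union> bad3 n)"
    \<comment> \<open>The budget is \<open>\<alpha> n / 4 + \<alpha> n / 4 + \<alpha> n / 2\<close>,
      matching the risk levels of the regression radii and the factor 2 inside the logarithm of
      \<open>\<xi>\<close>.\<close>
    have bad_le: "outer_measure_of P (bad n) \<le> ennreal (\<alpha> n)" if n: "n \<ge> 1" for n
    proof -
      have 1: "outer_measure_of P (bad1 n) \<le> ennreal (\<alpha> n / 4)"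
        using reg[rule_format, OF n \<alpha>4] unfolding bad1_def \<kappa>1_def by (rule conjunct2)
      have 2: "outer_measure_of P (bad2 n) \<le> ennreal (\<alpha> n / 4)"
        using reg_avg[rule_format, OF n \<alpha>4] unfolding bad2_def \<kappa>2_def by (rule conjunct2)
      have 3: "outer_measure_of P (bad3 n) \<le> ennreal (\<alpha> n / 2)"
        unfolding bad3_def
      proof (rule outer_measure_of_greater_le[OF t0])
        fix s assume s: "t n < s"
        have \<alpha>1: "\<alpha> n \<in> {0<..<1}" using \<alpha>[of n] by auto
        have "0 < s" using s t0[of n] by linarith
        then have "outer_measure_of P {\<omega> \<in> space P.
            wasserstein p (P_star f (dataset D n \<omega>) x z0) (\<nu> z0) \<ge> ennreal s}
            \<le> ennreal (c1 (\<alpha> n) * exp (- c2 (\<alpha> n) * real n * s powr c3 (\<alpha> n)))"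
          using conc[rule_format, OF \<alpha>1] n x z0 unfolding \<nu>_def by (elim conjE) blast
        also have "\<dots> \<le> ennreal (\<alpha> n / 2)"
          using conc[rule_format, OF \<alpha>1, THEN conjunct1] conc[rule_format, OF \<alpha>1, THEN conjunct2, THEN conjunct1]
            conc[rule_format, OF \<alpha>1, THEN conjunct2, THEN conjunct2, THEN conjunct1] \<alpha>[of n] n s
          unfolding t_def by (intro ennreal_leI exp_tail_le) auto
        finally show "outer_measure_of P {\<omega> \<in> space P.
            ennreal s \<le> wasserstein p (P_star f (dataset D n \<omega>) x z0) (\<nu> z0)} \<le> ennreal (\<alpha> n / 2)" .
      qed
      have "outer_measure_of P (bad n)
          \<le> outer_measure_of P (bad1 n) + outer_measure_of P (bad2 n) + outer_measure_of P (bad3 n)"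
        unfolding bad_def
        by (intro order_trans[OF outer_measure_of_Un_le] add_right_mono outer_measure_of_Un_le)
           (auto simp: bad1_def bad2_def bad3_def)
      also have "\<dots> \<le> ennreal (\<alpha> n / 4) + ennreal (\<alpha> n / 4) + ennreal (\<alpha> n / 2)"
        by (intro add_mono 1 2 3)
      also have "\<dots> = ennreal (\<alpha> n)"
        using \<alpha>[of n] by (simp add: ennreal_plus[symmetric] del: ennreal_plus)
      finally show ?thesis .
    qed

    \<comment> \<open>Deterministic bounds outside the exceptional event\<close>
    have good: "\<bar>vhat n \<omega> x - v x\<bar> \<le> B * r n \<and> \<bar>g (zhat n \<omega> x) x - v x\<bar> \<le> B * r n"
      if n: "n \<ge> 1" and \<omega>: "\<omega> \<in> space P" "\<omega> \<notin> bad n" and small: "3 * r n \<le> 1" for n \<omega>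
    proof -
      define \<mu> where "\<mu> = P_ER Ys (fhat n \<omega>) (dataset D n \<omega>) x"
      have ne: "dataset D n \<omega> \<noteq> []" using n by (simp add: dataset_def)
      have A_eq: "\<A> n \<omega> x z = wasserstein_ball p Ys (\<mu> z) (r n)" for z
        by (simp add: A_def \<mu>_def r_def)
      have W: "wasserstein p (\<nu> z) (\<mu> z) \<le> ennreal (r n)" if z: "z \<in> Zs" for z
      proof -
        have "wasserstein p (P_star f (dataset D n \<omega>) x z) (\<nu> z) \<le> ennreal (t n)"
          using \<omega> wasserstein_P_star_translate[OF p t0 msr, of f "dataset D n \<omega>" x z0 n z]
          by (auto simp: bad_def bad3_def \<nu>_def not_less)
        then show ?thesis
          unfolding \<mu>_def r_eq
          using p ne \<kappa>pos[OF n] t0[of n] nu[OF z] \<omega> z \<open>closed Ys\<close> \<open>convex Ys\<close> \<open>Ys \<noteq> {}\<close>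
          by (intro wasserstein_P_ER_le[where f = f and z = z])
             (auto simp: bad_def bad1_def bad2_def not_less)
      qed
      then have nu_A: "\<nu> z \<in> \<A> n \<omega> x z" if "z \<in> Zs" for z
        using that nu by (simp add: A_eq wasserstein_ball_def)
      \<comment> \<open>The true law is a member of the ambiguity set; finiteness of the robust
        objective makes the real supremum an upper bound.\<close>
      have g_le: "g z x \<le> obj n \<omega> z" if z: "z \<in> Zs" for z
        unfolding g_eq[OF z] obj_def dro_objective_def
        using dro_finite[OF n \<omega>(1) x z] nu_A[OF z]
        by (intro cSUP_upper) (auto simp: dro_objective_finite_def)
      have obj_le: "obj n \<omega> z0 \<le> g z0 x + 3 * r n * (h + K)"
        unfolding obj_def dro_objective_def
      proof (rule cSUP_least)
        show "\<A> n \<omega> x z0 \<noteq> {}" using nu_A[OF z0] by blast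
        fix Q assume Q: "Q \<in> \<A> n \<omega> x z0"
        then have Q': "Q \<in> prob_on Ys" "wasserstein p Q (\<mu> z0) \<le> ennreal (r n)"
          by (auto simp: A_eq wasserstein_ball_def)
        \<comment> \<open>Balls are closed while a plan requires a strict bound, hence the slack
          \<open>3 / 2\<close>. Two such plans, glued at the finitely supported centre
          \<open>\<mu> z0\<close>, give the scale \<open>3 * r n\<close>.\<close>
        have rn: "ennreal (r n) < ennreal (3 / 2 * r n)"
          using r0[OF n] by (simp add: ennreal_less_iff)
        have "transport_within p Q (\<mu> z0) (3 / 2 * r n)" "transport_within p (\<nu> z0) (\<mu> z0) (3 / 2 * r n)"
          using r0[OF n] order.strict_trans1[OF Q'(2) rn] order.strict_trans1[OF W[OF z0] rn] p
          by (intro transport_within_if_wasserstein_less; simp)+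
        then have "transport_within p Q (\<nu> z0) (3 / 2 * r n + 3 / 2 * r n)"
          unfolding \<mu>_def P_ER_def
        proof (rule transport_within_trans_finite_support[OF p _ _ _ _ AE_empirical_law _ transport_within_sym, rotated 4])
          show "prob_space (empirical_law (map (closest_point Ys) (shifted_residuals (fhat n \<omega>) (dataset D n \<omega>) x z0)))"
            using ne by (intro prob_space_empirical_law) (simp add: shifted_residuals_def)
        qed (use r0[OF n] in auto)
        \<comment> \<open>The modulus \<open>gap\<close> is used with \<open>e = 3 * r n\<close>,
          and \<open>small\<close> ensures \<open>e \<le> 1\<close>.\<close>
        then have "\<bar>(\<integral>y. c z0 y \<partial>Q) - (\<integral>y. c z0 y \<partial>\<nu> z0)\<bar> \<le> 3 * r n * (h + K)"
          using r0[OF n] small dro_finite[OF n \<omega>(1) x z0] Q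
          by (intro expectation_gap_le[OF Q'(1) nu[OF z0] _ int_nu[OF z0] H K _ gap])
             (auto simp: dro_objective_finite_def)
        then show "(\<integral>y. c z0 y \<partial>Q) \<le> g z0 x + 3 * r n * (h + K)"
          unfolding g_eq[OF z0] by linarith
      qed
      have zh: "zhat n \<omega> x \<in> Zs" "\<And>z. z \<in> Zs \<Longrightarrow> obj n \<omega> (zhat n \<omega> x) \<le> obj n \<omega> z"
        using zhat[OF n \<omega>(1) x] unfolding is_arg_min_linorder obj_def by auto
      have vh: "vhat n \<omega> x = obj n \<omega> (zhat n \<omega> x)"
        unfolding vhat_def obj_def[symmetric] using zh by (intro cInf_eq_minimum) (auto simp: obj_def)
      have "v x \<le> g (zhat n \<omega> x) x" using z0_min[OF zh(1)] v_eq by simp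
      moreover have "g (zhat n \<omega> x) x \<le> vhat n \<omega> x" using g_le[OF zh(1)] vh by simp
      moreover have "vhat n \<omega> x \<le> v x + 3 * r n * (h + K)" using zh(2)[OF z0] vh obj_le v_eq by simp
      moreover have "3 * r n * (h + K) \<le> B * r n" using r0[OF n] by (simp add: B_def algebra_simps)
      ultimately show ?thesis by linarith
    qed

    \<comment> \<open>Boundedness in probability\<close>
    have B: "B > 0" using H(4) K by (simp add: B_def)
    \<comment> \<open>The same \<open>B\<close> works for every \<open>\<delta>\<close>. Only the
      starting index depends on \<open>\<delta>\<close>, through
      \<open>\<alpha> n < \<delta>\<close>, which holds eventually because a summable sequence tends
      to 0.\<close>
    have bdd: "bounded_in_prob P A r" if A: "\<And>n \<omega>. n \<ge> 1 \<Longrightarrow> \<omega> \<in> space P \<Longrightarrow> \<omega> \<notin> bad n \<Longrightarrow>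
        3 * r n \<le> 1 \<Longrightarrow> \<bar>A n \<omega>\<bar> \<le> B * r n" for A
      unfolding bounded_in_prob_def
    proof (intro allI impI exI conjI)
      fix \<delta> :: real assume \<delta>: "0 < \<delta>"
      have "\<forall>\<^sub>F n in sequentially. \<alpha> n < \<delta>"
        using summable_LIMSEQ_zero[OF \<open>summable \<alpha>\<close>] \<delta> by (rule order_tendstoD)
      moreover have "\<forall>\<^sub>F n in sequentially. r n < 1 / 3"
        using lim unfolding r_def by (rule order_tendstoD) simp
      ultimately show "\<forall>\<^sub>F n in sequentially.
          outer_measure_of P {\<omega> \<in> space P. \<bar>A n \<omega>\<bar> > B * \<bar>r n\<bar>} \<le> ennreal \<delta>"
        using eventually_ge_at_top[of 1]
      proof eventually_elim
        case (elim n)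
        have "{\<omega> \<in> space P. \<bar>A n \<omega>\<bar> > B * \<bar>r n\<bar>} \<subseteq> bad n"
          using A[of n] elim r0[of n] by (force simp: not_le[symmetric])
        then have "outer_measure_of P {\<omega> \<in> space P. \<bar>A n \<omega>\<bar> > B * \<bar>r n\<bar>} \<le> outer_measure_of P (bad n)"
          by (rule outer_measure_of_mono)
        also have "\<dots> \<le> ennreal \<delta>"
          using bad_le[OF elim(3)] elim(1) by (meson ennreal_leI less_imp_le order_trans)
        finally show ?case .
      qed
    qed (rule B)
    show ?case
      unfolding r_def[symmetric] using good by (intro conjI bdd) auto
  qed
qed

end
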